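(* Consider the stochastic mirror descent iteration $\{x_n^\delta,\xi_n^\delta\}$ with noisy data $y^\delta$ and with the step-sizes $t_n^\delta$ chosen by rule (s3) (defined in the context), where $\tau>1$ and $\mu_0>0$ are chosen to satisfy $$1-\frac1\tau-\frac{\mu_0}{4\sigma}\ge 0.$$ If the integer $n_\delta$ is chosen such that $n_\delta\to\infty$ as $\delta\to0$, then $$\mathbb{E}\left[\|x_{n_\delta}^\delta-x^\dagger\|^2\right]\to 0\quad\text{and}\quad \mathbb{E}\left[D_{\mathcal R}^{\xi_{n_\delta}^\delta}(x^\dagger,x_{n_\delta}^\delta)\right]\to 0$$ as $\delta\to 0$.
   Context: Setting. $X$ is a Banach space with dual $X^*$ and duality pairing $\langle\cdot,\cdot\rangle$; $Y_1,\dots,Y_p$ are Hilbert spaces (identified with their duals); $A_i:X\to Y_i$ is a bounded linear operator for $i=1,\dots,p$. $\mathcal R:X\to(-\infty,\infty]$ is proper, lower semi-continuous and strongly convex with modulus of convexity $\sigma>0$, i.e. $\sigma$ is the largest number with $\mathcal R(t\bar x+(1-t)x)+\sigma t(1-t)\|\bar x-x\|^2\le t\mathcal R(\bar x)+(1-t)\mathcal R(x)$ for all $\bar x,x\in\mathrm{dom}(\mathcal R):=\{x:\mathcal R(x)<\infty\}$, $t\in[0,1]$. The system $A_ix=y_i$, $i=1,\dots,p$, has a solution in $\mathrm{dom}(\mathcal R)$; $x^\dagger$ denotes its unique $\mathcal R$-minimizing solution, i.e. the unique solution minimizing $\mathcal R$ among all solutions. For $\xi\in\partial\mathcal R(x)$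 (subdifferential), the Bregman distance is $D_{\mathcal R}^{\xi}(\bar x,x):=\mathcal R(\bar x)-\mathcal R(x)-\langle\xi,\bar x-x\rangle$. Noisy data. $y^\delta=(y_1^\delta,\dots,y_p^\delta)$, $y_i^\delta\in Y_i$, $\|y_i^\delta-y_i\|\le\delta_i$ with $\delta_i>0$, and $\delta:=(\delta_1^2+\dots+\delta_p^2)^{1/2}$. For $I=\{i_1,\dots,i_b\}\subset\{1,\dots,p\}$ put $Y_I:=Y_{i_1}\times\cdots\times Y_{i_b}$ (product Hilbert space), $A_Ix:=(A_{i_1}x,\dots,A_{i_b}x)$, $y_I^\delta:=(y_{i_1}^\delta,\dots,y_{i_b}^\delta)$, $\delta_I:=(\sum_{i\in I}\delta_i^2)^{1/2}$, and let $A_I^*:Y_I\to X^*$ be the adjoint of $A_I$. Algorithm (stochastic mirror descent). Fix a batch size $b\in\{1,\dots,p\}$. Let $I_0,I_1,\dots$ be independent random subsets of $\{1,\dots,p\}$, each uniformly distributed over the subsets of cardinality $b$; $\mathbb E$ is the expectation with respect to them. Set $\xi_0^\delta:=0\in X^*$ and for $n\ge0$ let $$x_n^\delta:=\arg\min_{x\in X}\{\mathcal R(x)-\langle\xi_n^\delta,x\rangle\},\qquad \xi_{n+1}^\delta:=\xi_n^\delta-t_n^\delta A_{I_n}^*(A_{I_n}x_n^\delta-y_{I_n}^\delta).$$ The minimizer exists and is unique, and $\xi_n^\delta\in\partial\mathcal R(x_n^\delta)$. Step-size rule (s3) (quotients with zero denominator, including $0/0$, are read as $+\infty$): $t_n^\delta=\min\left\{\frac{\mu_0\|A_{I_n}x_n^\delta-y_{I_n}^\delta\|^2}{\|A_{I_n}^*(A_{I_n}x_n^\delta-y_{I_n}^\delta)\|^2},\tilde\mu_1\right\}$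 if $\|A_{I_n}x_n^\delta-y_{I_n}^\delta\|>\tau\delta_{I_n}$, and $t_n^\delta=0$ otherwise, with fixed constants $\tau\ge1$, $0<\mu_0<4\sigma$, $\tilde\mu_1>0$. The limit $\delta\to0$ is taken along any family of noise levels $(\delta_1,\dots,\delta_p)$ with $\delta\to 0$ and corresponding noisy data, with everything else ($X,Y_i,A_i,\mathcal R,y_i,b,\mu_0,\tilde\mu_1,\tau$) fixed; $n_\delta$ is a deterministic integer attached to each noise level. *)

theory Defs
  imports "HOL-Probability.Probability"
begin

section \<open>Convex functions with values in the extended reals\<close>

text \<open>The dual of \<open>'x\<close> is the Banach space \<open>'x \<Rightarrow>\<^sub>L real\<close> with the operator norm; the pairing
  of \<open>\<xi>\<close> and \<open>x\<close> is the application \<open>\<xi> x\<close>.\<close>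

definition eff_dom :: "('x \<Rightarrow> ereal) \<Rightarrow> 'x set" where
  "eff_dom R = {x. R x < \<infinity>}"

definition proper :: "('x \<Rightarrow> ereal) \<Rightarrow> bool" where
  "proper R \<longleftrightarrow> (\<forall>x. R x \<noteq> -\<infinity>) \<and> eff_dom R \<noteq> {}"

definition lower_semicontinuous :: "('x::topological_space \<Rightarrow> ereal) \<Rightarrow> bool" where
  "lower_semicontinuous R \<longleftrightarrow> (\<forall>x. R x \<le> Liminf (at x) R)"

definition strongly_convex_with :: "('x::real_normed_vector \<Rightarrow> ereal) \<Rightarrow> real \<Rightarrow> bool" where
  "strongly_convex_with R c \<longleftrightarrow>
     (\<forall>x'\<in>eff_dom R. \<forall>x\<in>eff_dom R. \<forall>t\<in>{0..1}.
        R (t *\<^sub>R x' + (1 - t) *\<^sub>R x) + ereal (c * t * (1 - t) * (norm (x' - x))\<^sup>2)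
          \<le> ereal t * R x' + ereal (1 - t) * R x)"

definition modulus_of_convexity :: "('x::real_normed_vector \<Rightarrow> ereal) \<Rightarrow> real \<Rightarrow> bool" where
  "modulus_of_convexity R \<sigma> \<longleftrightarrow>
     strongly_convex_with R \<sigma> \<and> (\<forall>c. strongly_convex_with R c \<longrightarrow> c \<le> \<sigma>)"

text \<open>Intended for \<open>\<xi>\<close> in the subdifferential of \<open>R\<close> at \<open>x\<close>. For \<open>R\<close> proper and \<open>x\<close>, \<open>x'\<close> in
  \<open>eff_dom R\<close> the value is finite.\<close>

definition bregman ::
  "('x::real_normed_vector \<Rightarrow> ereal) \<Rightarrow> ('x \<Rightarrow>\<^sub>L real) \<Rightarrow> 'x \<Rightarrow> 'x \<Rightarrow> ereal" where
  "bregman R \<xi> x' x = R x' - R x - ereal (blinfun_apply \<xi> (x' - x))"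

section \<open>Finite products of Hilbert spaces\<close>

text \<open>The Hilbert spaces \<open>Y i\<close> may differ from each other. They are modelled as complete linear
  subspaces of one inner product space \<open>'y\<close>; this covers every finite family of Hilbert
  spaces, since each of them embeds isometrically into the direct sum. An element of the product
  \<open>Y_J\<close> is a family \<open>v\<close> of which only the values \<open>v i\<close> with \<open>i \<in> J\<close> matter.\<close>

definition hilbert_subspace :: "'y::real_inner set \<Rightarrow> bool" where
  "hilbert_subspace H \<longleftrightarrow> subspace H \<and> Topological_Spaces.complete H"

definition prod_inner :: "nat set \<Rightarrow> (nat \<Rightarrow> 'y::real_inner) \<Rightarrow> (nat \<Rightarrow> 'y) \<Rightarrow> real" where
  "prod_inner J u v = (\<Sum>i\<in>J. u i \<bullet> v i)"

definition prod_norm :: "nat set \<Rightarrow> (nat \<Rightarrow> 'y::real_inner) \<Rightarrow> real" where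
  "prod_norm J u = sqrt (prod_inner J u u)"

definition noise_level :: "nat set \<Rightarrow> (nat \<Rightarrow> real) \<Rightarrow> real" where
  "noise_level J \<delta> = sqrt (\<Sum>i\<in>J. (\<delta> i)\<^sup>2)"

text \<open>\<open>batch_adjoint A J\<close> is the map \<open>A_J\<^sup>* : Y_J \<rightarrow> X\<^sup>*\<close>, where \<open>A_J x\<close> is the family
  \<open>\<lambda>i. A i x\<close>.\<close>

definition batch_adjoint ::
  "(nat \<Rightarrow> 'x::real_normed_vector \<Rightarrow>\<^sub>L 'y::real_inner) \<Rightarrow> nat set \<Rightarrow> (nat \<Rightarrow> 'y) \<Rightarrow> ('x \<Rightarrow>\<^sub>L real)" where
  "batch_adjoint A J v = Blinfun (\<lambda>x. prod_inner J v (\<lambda>i. blinfun_apply (A i) x))"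

lemma batch_adjoint_apply:
  "blinfun_apply (batch_adjoint A J v) x = prod_inner J v (\<lambda>i. blinfun_apply (A i) x)"
proof -
  have "bounded_linear (\<lambda>x. prod_inner J v (\<lambda>i. blinfun_apply (A i) x))"
    unfolding prod_inner_def
    by (intro bounded_linear_sum bounded_linear_inner_right_comp blinfun.bounded_linear_right)
  then show ?thesis
    by (simp add: batch_adjoint_def bounded_linear_Blinfun_apply)
qed

definition residual ::
  "(nat \<Rightarrow> 'x::real_normed_vector \<Rightarrow>\<^sub>L 'y::real_inner) \<Rightarrow> (nat \<Rightarrow> 'y) \<Rightarrow> 'x \<Rightarrow> nat \<Rightarrow> 'y" where
  "residual A yd x = (\<lambda>i. blinfun_apply (A i) x - yd i)"

section \<open>Stochastic mirror descent\<close>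

definition mirror_map ::
  "('x::real_normed_vector \<Rightarrow> ereal) \<Rightarrow> ('x \<Rightarrow>\<^sub>L real) \<Rightarrow> 'x" where
  "mirror_map R \<xi> = (ARG_MIN (\<lambda>x. R x - ereal (blinfun_apply \<xi> x)) x. True)"

text \<open>A quotient with zero denominator counts as \<open>+\<infinity>\<close>, so in that case the minimum of the
  quotient and \<open>\<mu>1\<close> is \<open>\<mu>1\<close>.\<close>

definition step_size ::
  "(nat \<Rightarrow> 'x::real_normed_vector \<Rightarrow>\<^sub>L 'y::real_inner) \<Rightarrow> real \<Rightarrow> real \<Rightarrow> real \<Rightarrow>
   (nat \<Rightarrow> real) \<Rightarrow> nat set \<Rightarrow> (nat \<Rightarrow> 'y) \<Rightarrow> real" where
  "step_size A \<mu>0 \<mu>1 \<tau> \<delta> J r =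
     (if prod_norm J r > \<tau> * noise_level J \<delta> then
        (if norm (batch_adjoint A J r) = 0 then \<mu>1
         else min (\<mu>0 * (prod_norm J r)\<^sup>2 / (norm (batch_adjoint A J r))\<^sup>2) \<mu>1)
      else 0)"

text \<open>The iterates for data \<open>yd\<close>, noise levels \<open>\<delta>\<close> and a given realisation \<open>J\<close> of the sequence of
  batches.\<close>

primrec smd_dual ::
  "('x::real_normed_vector \<Rightarrow> ereal) \<Rightarrow> (nat \<Rightarrow> 'x \<Rightarrow>\<^sub>L 'y::real_inner) \<Rightarrow>
   real \<Rightarrow> real \<Rightarrow> real \<Rightarrow> (nat \<Rightarrow> real) \<Rightarrow> (nat \<Rightarrow> 'y) \<Rightarrow> (nat \<Rightarrow> nat set) \<Rightarrow> nat \<Rightarrow> ('x \<Rightarrow>\<^sub>L real)" where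
  "smd_dual R A \<mu>0 \<mu>1 \<tau> \<delta> yd J 0 = 0"
| "smd_dual R A \<mu>0 \<mu>1 \<tau> \<delta> yd J (Suc n) =
     (let \<xi> = smd_dual R A \<mu>0 \<mu>1 \<tau> \<delta> yd J n;
          r = residual A yd (mirror_map R \<xi>)
      in \<xi> - step_size A \<mu>0 \<mu>1 \<tau> \<delta> (J n) r *\<^sub>R batch_adjoint A (J n) r)"

definition smd_primal ::
  "('x::real_normed_vector \<Rightarrow> ereal) \<Rightarrow> (nat \<Rightarrow> 'x \<Rightarrow>\<^sub>L 'y::real_inner) \<Rightarrow>
   real \<Rightarrow> real \<Rightarrow> real \<Rightarrow> (nat \<Rightarrow> real) \<Rightarrow> (nat \<Rightarrow> 'y) \<Rightarrow> (nat \<Rightarrow> nat set) \<Rightarrow> nat \<Rightarrow> 'x" where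
  "smd_primal R A \<mu>0 \<mu>1 \<tau> \<delta> yd J n = mirror_map R (smd_dual R A \<mu>0 \<mu>1 \<tau> \<delta> yd J n)"

definition batches :: "nat \<Rightarrow> nat \<Rightarrow> nat set set" where
  "batches p b = {J. J \<subseteq> {1..p} \<and> card J = b}"

definition iid_uniform_batches ::
  "'w measure \<Rightarrow> nat \<Rightarrow> nat \<Rightarrow> (nat \<Rightarrow> 'w \<Rightarrow> nat set) \<Rightarrow> bool" where
  "iid_uniform_batches M p b I \<longleftrightarrow>
     prob_space.indep_vars M (\<lambda>_. count_space (batches p b)) I UNIV \<and>
     (\<forall>n. distr M (count_space (batches p b)) (I n) = uniform_count_measure (batches p b))"

end

theory Submission
  imports Defs
begin

text \<open>Write \<open>X \<xi>\<close> for the minimizer of \<open>R - \<xi>\<close> and \<open>gap \<xi>\<close> for the Bregman distance from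
  \<open>xdag\<close> to \<open>X \<xi>\<close>. Strong convexity gives \<open>\<sigma> * (norm (X \<xi> - xdag))\<^sup>2 \<le> gap \<xi>\<close>, so it suffices that
  the expected gap tends to zero.

  Along every sequence of batches the gap never increases, because the discrepancy test
  switches the step off as soon as noise could dominate the residual (\<open>gap_decrease\<close>). For a fixed
  number of steps the noisy iterate depends continuously on the data at the exact data
  (\<open>dual_tendsto_exact\<close>); only finitely many sequences of batches matter, so the expected gap after
  \<open>n\<close> noisy steps tends to the expected gap after \<open>n\<close> exact steps. By monotonicity this bounds the
  expected gap after \<open>N k \<ge> n\<close> steps, and everything reduces to the exact method: its expected
  gap must become arbitrarily small for some \<open>n\<close>.

  For exact data the expected squared misfits \<open>s n\<close> are summable, since a fixed
  multiple of the expected loss of gap in one step dominates each of them. The gap splits into \<open>R xdag - R x\<close> and \<open>\<xi> (x - xdag)\<close>. The first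
  part is small when the misfit is small: otherwise nearly feasible points of value bounded away below
  \<open>R xdag\<close> would exist, and strong convexity would make them converge to a solution better than
  \<open>xdag\<close> (\<open>near_feasible_value\<close>). For the second part, \<open>\<xi>\<close> is a combination of the adjoints applied to
  the earlier residuals, so the expectation of this part is at most a multiple of the sum of
  \<open>sqrt (s m * s n)\<close> over \<open>m < n\<close>. For a summable sequence this sum is small at suitable indices \<open>n\<close>,
  namely those where \<open>s\<close> is minimal on a long interval (\<open>almost_minimal_index\<close>). No limit of the random
  iterates has to be constructed.\<close>

section \<open>Lower semicontinuous strongly convex functions\<close>

text \<open>Extended-real arithmetic is avoided by describing a convex function by its effective domain
  and its real values there; lower semicontinuity becomes closedness of the sublevel sets.\<close>

locale strongly_convex_lsc =
  fixes D :: "'x::banach set" and f :: "'x \<Rightarrow> real" and \<sigma> :: real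
  assumes dom_nonempty: "D \<noteq> {}"
    and modulus_pos: "0 < \<sigma>"
    and sublevel_closed: "closed {x\<in>D. f x \<le> c}"
    and dom_convex: "x \<in> D \<Longrightarrow> z \<in> D \<Longrightarrow> 0 \<le> t \<Longrightarrow> t \<le> 1 \<Longrightarrow> t *\<^sub>R x + (1 - t) *\<^sub>R z \<in> D"
    and strong_convexity: "x \<in> D \<Longrightarrow> z \<in> D \<Longrightarrow> 0 \<le> t \<Longrightarrow> t \<le> 1 \<Longrightarrow>
      f (t *\<^sub>R x + (1 - t) *\<^sub>R z) + \<sigma> * t * (1 - t) * (norm (x - z))\<^sup>2 \<le> t * f x + (1 - t) * f z"
begin

lemma sublevel_convex: "convex {x\<in>D. f x \<le> c}"
proof (rule convexI)
  fix x z and u v :: real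
  assume x: "x \<in> {x\<in>D. f x \<le> c}" and z: "z \<in> {x\<in>D. f x \<le> c}"
    and u: "0 \<le> u" and v: "0 \<le> v" and uv: "u + v = 1"
  have v': "v = 1 - u" and u1: "u \<le> 1" using uv v by linarith+
  have "0 \<le> \<sigma> * u * (1 - u) * (norm (x - z))\<^sup>2"
    using modulus_pos u u1 by simp
  then have "f (u *\<^sub>R x + v *\<^sub>R z) \<le> u * f x + v * f z"
    using strong_convexity[of x z u] x z u u1 v' by auto
  also have "\<dots> \<le> u * c + v * c"
    using x z u v by (intro add_mono mult_left_mono) auto
  also have "\<dots> = c" using uv by (simp flip: distrib_right)
  finally show "u *\<^sub>R x + v *\<^sub>R z \<in> {x\<in>D. f x \<le> c}"
    using dom_convex[of x z u] x z u u1 v' by auto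
qed

text \<open>Near a point \<open>x0\<close> of the domain the function is bounded below by semicontinuity. Far away,
  strong convexity on the segment towards \<open>x0\<close> bounds \<open>f x\<close> below by a quadratic function of the distance
  with positive leading coefficient. This replaces an affine minorant obtained from Hahn-Banach.\<close>

lemma bounded_below: "\<exists>m. \<forall>x\<in>D. m \<le> f x"
proof -
  obtain x0 where x0: "x0 \<in> D" using dom_nonempty by blast
  have "open (- {x\<in>D. f x \<le> f x0 - 1})"
    using sublevel_closed by (simp add: open_Compl)
  moreover have "x0 \<in> - {x\<in>D. f x \<le> f x0 - 1}" by simp
  ultimately obtain r where r: "0 < r" and near: "ball x0 r \<subseteq> - {x\<in>D. f x \<le> f x0 - 1}"
    by (meson open_contains_ball)
  have "min (f x0 - 1) (f x0 - 2 / (\<sigma> * r\<^sup>2)) \<le> f x" if x: "x \<in> D" for x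
  proof (cases "norm (x - x0) < r")
    case True
    then have "x \<in> ball x0 r" by (simp add: dist_norm norm_minus_commute)
    then show ?thesis using near x by force
  next
    case False
    define d where "d = norm (x - x0)"
    \<comment> \<open>With this weight the intermediate point has distance \<open>r / 2\<close> from \<open>x0\<close>.\<close>
    define t where "t = r / (2 * d)"
    have d: "r \<le> d" "0 < d" using False r by (auto simp: d_def)
    have t: "0 < t" "t \<le> 1 / 2" using d r by (auto simp: t_def field_simps)
    define z where "z = t *\<^sub>R x + (1 - t) *\<^sub>R x0"
    have "z - x0 = t *\<^sub>R (x - x0)" by (simp add: z_def algebra_simps)
    then have "norm (z - x0) = r / 2" using r t d by (simp add: d_def[symmetric] t_def)
    then have "z \<in> ball x0 r" using r by (simp add: dist_norm norm_minus_commute)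
    moreover have "z \<in> D" unfolding z_def using x x0 t by (intro dom_convex) auto
    ultimately have "f x0 - 1 < f z" using near by force
    moreover have "f z + \<sigma> * t * (1 - t) * d\<^sup>2 \<le> t * f x + (1 - t) * f x0"
      unfolding z_def d_def using x x0 t by (intro strong_convexity) auto
    ultimately have "t * f x0 - 1 + t * (\<sigma> * (1 - t) * d\<^sup>2) \<le> t * f x"
      by (simp add: algebra_simps)
    then have "t * (f x0 - 1 / t + \<sigma> * (1 - t) * d\<^sup>2) \<le> t * f x"
      using t by (simp add: algebra_simps)
    then have "f x0 - 1 / t + \<sigma> * (1 - t) * d\<^sup>2 \<le> f x" using t by simp
    moreover have "\<sigma> * (1 / 2) * d\<^sup>2 \<le> \<sigma> * (1 - t) * d\<^sup>2"
      using t modulus_pos by (intro mult_right_mono mult_left_mono) auto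
    moreover have "1 / t = 2 * d / r" by (simp add: t_def)
    ultimately have "f x0 - 2 * d / r + \<sigma> / 2 * d\<^sup>2 \<le> f x" by simp
    moreover have "0 \<le> \<sigma> / 2 * (d - 2 / (\<sigma> * r))\<^sup>2" using modulus_pos by simp
    moreover have "\<sigma> / 2 * (d - 2 / (\<sigma> * r))\<^sup>2 = \<sigma> / 2 * d\<^sup>2 - 2 * d / r + 2 / (\<sigma> * r\<^sup>2)"
      using modulus_pos r by (simp add: field_simps power2_eq_square)
    ultimately show ?thesis by simp
  qed
  then show ?thesis by blast
qed

text \<open>A weak-compactness statement that holds in any Banach space: pick almost minimizers of \<open>f\<close> on each
  set. The midpoint of two of them lies in the larger set, so strong convexity bounds their distance by
  the increase of the infima, and the infima converge because they are bounded by \<open>B\<close>. It yields both the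
  existence of minimizers and the stability of the minimal value under relaxed constraints.\<close>

lemma nested_convex_sets_meet:
  fixes E :: "nat \<Rightarrow> 'x set"
  assumes sub: "\<And>k. E k \<subseteq> {x\<in>D. f x \<le> B}" and ne: "\<And>k. E k \<noteq> {}"
    and conv: "\<And>k. convex (E k)" and cl: "\<And>k. closed (E k)" and dec: "decseq E"
  shows "\<exists>x. \<forall>k. x \<in> E k"
proof -
  obtain m0 where m0: "\<And>x. x \<in> D \<Longrightarrow> m0 \<le> f x" using bounded_below by blast
  define m where "m = (\<lambda>k. Inf (f ` E k))"
  have bdd: "bdd_below (f ` E k)" for k
    using m0 sub by (intro bdd_belowI[of _ m0]) blast
  have mle: "m k \<le> f x" if "x \<in> E k" for k x
    unfolding m_def using bdd that by (intro cInf_lower) auto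
  have m_inc: "incseq m"
  proof (rule incseq_SucI)
    fix k
    have "E (Suc k) \<subseteq> E k" using dec by (simp add: decseq_Suc_iff)
    then show "m k \<le> m (Suc k)" unfolding m_def
      using ne bdd by (intro cInf_superset_mono) auto
  qed
  have mB: "m k \<le> B" for k using ne[of k] mle[of _ k] sub[of k] by fastforce
  obtain l where lim: "m \<longlonglongrightarrow> l" and ml: "\<And>k. m k \<le> l"
    using incseq_convergent[OF m_inc, of B] mB by blast
  have "\<exists>x\<in>E k. f x < m k + 1 / real (Suc k)" for k
    using cInf_lessD[of "f ` E k" "m k + 1 / real (Suc k)"] ne[of k] by (auto simp: m_def)
  then obtain x where x: "\<And>k. x k \<in> E k" and fx: "\<And>k. f (x k) < m k + 1 / real (Suc k)"
    by metis
  define a where "a = (\<lambda>k. 4 / \<sigma> * ((l - m k) / 2 + 1 / real (Suc k)))"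
  have gap: "(norm (x j - x k))\<^sup>2 \<le> a k" if "k \<le> j" for j k
  proof -
    have jk: "x j \<in> E k" using x[of j] dec that by (auto simp: decseq_def)
    let ?z = "(1/2) *\<^sub>R x j + (1 - 1/2) *\<^sub>R x k"
    have "?z \<in> E k" using convexD[OF conv jk x[of k], of "1/2" "1/2"] by simp
    then have "m k \<le> f ?z" by (rule mle)
    moreover have "f ?z + \<sigma> * (1/2) * (1 - 1/2) * (norm (x j - x k))\<^sup>2
        \<le> 1/2 * f (x j) + (1 - 1/2) * f (x k)"
      using jk x[of k] sub[of k] by (intro strong_convexity) auto
    moreover have "1 / real (Suc j) \<le> 1 / real (Suc k)" using that by (simp add: frac_le)
    ultimately have "\<sigma> / 4 * (norm (x j - x k))\<^sup>2 \<le> (l - m k) / 2 + 1 / real (Suc k)"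
      using fx[of j] fx[of k] ml[of j] by argo
    then have "4 / \<sigma> * (\<sigma> / 4 * (norm (x j - x k))\<^sup>2) \<le> a k"
      unfolding a_def using modulus_pos by (intro mult_left_mono) auto
    then show ?thesis using modulus_pos by simp
  qed
  have "(\<lambda>k. 4 / \<sigma> * ((l - m k) / 2 + 1 / real (Suc k))) \<longlonglongrightarrow> 4 / \<sigma> * ((l - l) / 2 + 0)"
    using LIMSEQ_inverse_real_of_nat modulus_pos
    by (intro tendsto_intros lim) (simp_all add: inverse_eq_divide del: of_nat_Suc)
  then have a0: "a \<longlonglongrightarrow> 0" by (simp add: a_def)
  have "Cauchy x"
    unfolding Cauchy_altdef2
  proof (intro allI impI)
    fix e :: real assume e: "0 < e"
    then have "eventually (\<lambda>k. a k < e\<^sup>2) sequentially"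
      by (intro order_tendstoD(2)[OF a0]) simp
    then obtain K where K: "a K < e\<^sup>2" by (auto simp: eventually_sequentially)
    have "dist (x n) (x K) < e" if "K \<le> n" for n
      using gap[OF that] K e by (intro power2_less_imp_less[of _ e]) (auto simp: dist_norm)
    then show "\<exists>N. \<forall>n\<ge>N. dist (x n) (x N) < e" by blast
  qed
  then obtain z where z: "x \<longlonglongrightarrow> z" using Cauchy_convergent convergent_def by blast
  have "z \<in> E k" for k
  proof (rule Lim_in_closed_set[OF cl[of k] _ _ z])
    show "\<forall>\<^sub>F n in sequentially. x n \<in> E k"
      using x dec by (auto simp: eventually_sequentially decseq_def intro!: exI[of _ k])
  qed simp
  then show ?thesis by blast
qed

lemma minimizer_exists: "\<exists>x\<in>D. \<forall>z\<in>D. f x \<le> f z"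
proof -
  obtain m0 where m0: "\<And>x. x \<in> D \<Longrightarrow> m0 \<le> f x" using bounded_below by blast
  define m where "m = Inf (f ` D)"
  have bdd: "bdd_below (f ` D)" using m0 by (intro bdd_belowI[of _ m0]) blast
  define E where "E = (\<lambda>k::nat. {x\<in>D. f x \<le> m + 1 / real (Suc k)})"
  have "\<exists>x. \<forall>k. x \<in> E k"
  proof (rule nested_convex_sets_meet[of E "m + 1"])
    show "E k \<subseteq> {x \<in> D. f x \<le> m + 1}" for k
    proof -
      have "1 / real (Suc k) \<le> 1" by simp
      then show ?thesis unfolding E_def by (smt (verit) Collect_mono)
    qed
    show "E k \<noteq> {}" for k
      using cInf_lessD[of "f ` D" "m + 1 / real (Suc k)"] dom_nonempty
      by (fastforce simp: m_def E_def)
    show "convex (E k)" "closed (E k)" for k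
      unfolding E_def by (rule sublevel_convex sublevel_closed)+
    show "decseq E"
    proof (rule decseq_SucI)
      fix k
      have "1 / real (Suc (Suc k)) \<le> 1 / real (Suc k)" by (simp add: frac_le)
      then show "E (Suc k) \<subseteq> E k" unfolding E_def by (smt (verit) Collect_mono)
    qed
  qed
  then obtain x where x: "\<And>k. x \<in> D \<and> f x \<le> m + 1 / real (Suc k)" by (auto simp: E_def)
  have "(\<lambda>k. m + 1 / real (Suc k)) \<longlonglongrightarrow> m + 0"
    using LIMSEQ_inverse_real_of_nat
    by (intro tendsto_intros) (simp add: inverse_eq_divide del: of_nat_Suc)
  then have "f x \<le> m" using x by (intro LIMSEQ_le_const[of _ m "f x"]) auto
  moreover have "m \<le> f z" if "z \<in> D" for z
    unfolding m_def using bdd that by (intro cInf_lower) auto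
  ultimately show ?thesis using x by (meson order_trans)
qed

text \<open>Compare \<open>f x\<close> with the values on the segment from \<open>x\<close> to \<open>z\<close> and let the weight of \<open>z\<close> tend to
  zero.\<close>

lemma quadratic_growth:
  assumes x: "x \<in> D" and least: "\<And>z. z \<in> D \<Longrightarrow> f x \<le> f z" and z: "z \<in> D"
  shows "f x + \<sigma> * (norm (z - x))\<^sup>2 \<le> f z"
proof -
  let ?q = "\<sigma> * (norm (z - x))\<^sup>2"
  have *: "f x + (1 - t) * ?q \<le> f z" if t: "0 < t" "t < 1" for t
  proof -
    have "f x \<le> f (t *\<^sub>R z + (1 - t) *\<^sub>R x)" using x z t by (intro least dom_convex) auto
    then have "f x + \<sigma> * t * (1 - t) * (norm (z - x))\<^sup>2 \<le> t * f z + (1 - t) * f x"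
      using strong_convexity[of z x t] x z t by auto
    then have "t * (f x + (1 - t) * ?q) \<le> t * f z" by (simp add: algebra_simps)
    then show ?thesis using t by simp
  qed
  have "((\<lambda>t. f x + (1 - t) * ?q) \<longlongrightarrow> f x + (1 - 0) * ?q) (at_right 0)"
    by (intro tendsto_intros)
  moreover have "\<forall>\<^sub>F t in at_right 0. f x + (1 - t) * ?q \<le> f z"
    unfolding eventually_at_right_field using * by (auto intro!: exI[of _ 1])
  ultimately have "f x + (1 - 0) * ?q \<le> f z"
    by (rule tendsto_upperbound) simp
  then show ?thesis by simp
qed

lemma subtract_linear: "strongly_convex_lsc D (\<lambda>x. f x - blinfun_apply \<xi> x) \<sigma>"
proof
  show "D \<noteq> {}" "0 < \<sigma>" by (rule dom_nonempty modulus_pos)+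
  show "closed {x\<in>D. f x - blinfun_apply \<xi> x \<le> c}" for c
    unfolding closed_sequential_limits
  proof (intro allI impI)
    fix s l assume "(\<forall>n. s n \<in> {x\<in>D. f x - blinfun_apply \<xi> x \<le> c}) \<and> s \<longlonglongrightarrow> l"
    then have s: "\<And>n. s n \<in> D" "\<And>n. f (s n) \<le> c + blinfun_apply \<xi> (s n)" and l: "s \<longlonglongrightarrow> l"
      by (auto simp: algebra_simps)
    have lin: "(\<lambda>n. c + blinfun_apply \<xi> (s n)) \<longlonglongrightarrow> c + blinfun_apply \<xi> l"
      by (intro tendsto_intros l)
    have "l \<in> {x\<in>D. f x \<le> c + blinfun_apply \<xi> l + e}" if "0 < e" for e
    proof (rule Lim_in_closed_set[OF sublevel_closed _ _ l])
      have "\<forall>\<^sub>F n in sequentially. c + blinfun_apply \<xi> (s n) < c + blinfun_apply \<xi> l + e"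
        using that by (intro order_tendstoD(2)[OF lin]) simp
      then show "\<forall>\<^sub>F n in sequentially. s n \<in> {x\<in>D. f x \<le> c + blinfun_apply \<xi> l + e}"
        by eventually_elim (use s in \<open>force intro: order_trans less_imp_le\<close>)
    qed simp
    then have "l \<in> D" "\<And>e. 0 < e \<Longrightarrow> f l \<le> c + blinfun_apply \<xi> l + e"
      using zero_less_one by blast+
    then show "l \<in> {x\<in>D. f x - blinfun_apply \<xi> x \<le> c}"
      using field_le_epsilon[of "f l" "c + blinfun_apply \<xi> l"] by (simp add: algebra_simps)
  qed
next
  fix x z and t :: real assume "x \<in> D" "z \<in> D" "0 \<le> t" "t \<le> 1"
  then show "t *\<^sub>R x + (1 - t) *\<^sub>R z \<in> D"
    and "f (t *\<^sub>R x + (1 - t) *\<^sub>R z) - blinfun_apply \<xi> (t *\<^sub>R x + (1 - t) *\<^sub>R z) +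
      \<sigma> * t * (1 - t) * (norm (x - z))\<^sup>2
      \<le> t * (f x - blinfun_apply \<xi> x) + (1 - t) * (f z - blinfun_apply \<xi> z)"
    using dom_convex[of x z t] strong_convexity[of x z t]
    by (simp_all add: blinfun.add_right blinfun.scaleR_right)
       (simp add: algebra_simps)
qed

end

lemma ereal_strongly_convex_lsc:
  fixes R :: "'x::banach \<Rightarrow> ereal"
  assumes proper: "proper R" and lsc: "lower_semicontinuous R"
    and sc: "strongly_convex_with R \<sigma>" and \<sigma>: "0 < \<sigma>"
  shows "strongly_convex_lsc (eff_dom R) (\<lambda>x. real_of_ereal (R x)) \<sigma>"
proof
  have fin: "ereal (real_of_ereal (R x)) = R x" if "x \<in> eff_dom R" for x
    using proper that by (auto simp: proper_def eff_dom_def ereal_real)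
  show "eff_dom R \<noteq> {}" using proper by (simp add: proper_def)
  show "0 < \<sigma>" by (rule \<sigma>)
  show "closed {x\<in>eff_dom R. real_of_ereal (R x) \<le> c}" for c
  proof -
    have eq: "{x\<in>eff_dom R. real_of_ereal (R x) \<le> c} = - {x. ereal c < R x}"
    proof -
      have "(x \<in> eff_dom R \<and> real_of_ereal (R x) \<le> c) = (\<not> ereal c < R x)" for x
        using proper by (cases "R x") (auto simp: proper_def eff_dom_def)
      then show ?thesis by auto
    qed
    have "open {x. ereal c < R x}"
      unfolding open_subopen[of "{x. ereal c < R x}"]
    proof
      fix x assume "x \<in> {x. ereal c < R x}"
      then have x: "ereal c < R x" by simp
      also have "\<dots> \<le> Liminf (at x) R" using lsc by (simp add: lower_semicontinuous_def)
      finally have "\<forall>\<^sub>F z in at x. ereal c < R z" by (rule less_LiminfD)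
      then obtain S where "open S" "x \<in> S" "\<And>z. z \<in> S \<Longrightarrow> z \<noteq> x \<Longrightarrow> ereal c < R z"
        by (auto simp: eventually_at_topological)
      then show "\<exists>T. open T \<and> x \<in> T \<and> T \<subseteq> {x. ereal c < R x}"
        using x by (intro exI[of _ S]) auto
    qed
    then show ?thesis unfolding eq by (rule closed_Compl)
  qed
  fix x z and t :: real assume xz: "x \<in> eff_dom R" "z \<in> eff_dom R" and t: "0 \<le> t" "t \<le> 1"
  let ?w = "t *\<^sub>R x + (1 - t) *\<^sub>R z"
  have ineq: "R ?w + ereal (\<sigma> * t * (1 - t) * (norm (x - z))\<^sup>2)
      \<le> ereal (t * real_of_ereal (R x) + (1 - t) * real_of_ereal (R z))"
    using sc xz t fin[OF xz(1), symmetric] fin[OF xz(2), symmetric]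
    by (simp add: strongly_convex_with_def) (metis atLeastAtMost_iff times_ereal.simps(1) plus_ereal.simps(1))
  then show w: "?w \<in> eff_dom R" by (cases "R ?w") (auto simp: eff_dom_def)
  show "real_of_ereal (R ?w) + \<sigma> * t * (1 - t) * (norm (x - z))\<^sup>2
      \<le> t * real_of_ereal (R x) + (1 - t) * real_of_ereal (R z)"
    using ineq by (subst (asm) fin[OF w, symmetric]) simp
qed


section \<open>Norms on the finite products\<close>

lemma prod_norm_L2: "prod_norm J u = L2_set (\<lambda>i. norm (u i)) J"
  by (simp add: prod_norm_def prod_inner_def L2_set_def power2_norm_eq_inner)

lemma noise_level_L2: "noise_level J \<delta> = L2_set \<delta> J"
  by (simp add: noise_level_def L2_set_def)

lemma prod_norm_nonneg [simp]: "0 \<le> prod_norm J u"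
  by (simp add: prod_norm_L2)

lemma prod_norm_power2: "(prod_norm J u)\<^sup>2 = (\<Sum>i\<in>J. (norm (u i))\<^sup>2)"
  by (simp add: prod_norm_L2 L2_set_def sum_nonneg)

lemma prod_inner_self: "prod_inner J u u = (prod_norm J u)\<^sup>2"
  by (simp add: prod_norm_power2 prod_inner_def power2_norm_eq_inner)

lemma prod_norm_mono: "K \<subseteq> J \<Longrightarrow> finite J \<Longrightarrow> prod_norm K u \<le> prod_norm J u"
  by (rule power2_le_imp_le) (auto simp: prod_norm_power2 intro: sum_mono2)

lemma prod_inner_Cauchy_Schwarz: "\<bar>prod_inner J u v\<bar> \<le> prod_norm J u * prod_norm J v"
proof -
  have "\<bar>prod_inner J u v\<bar> \<le> (\<Sum>i\<in>J. \<bar>norm (u i)\<bar> * \<bar>norm (v i)\<bar>)"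
    unfolding prod_inner_def
    by (intro order_trans[OF sum_abs] sum_mono) (simp add: Cauchy_Schwarz_ineq2)
  also have "\<dots> \<le> prod_norm J u * prod_norm J v"
    unfolding prod_norm_L2 by (rule L2_set_mult_ineq)
  finally show ?thesis .
qed

lemma prod_norm_le_noise:
  assumes "\<And>i. i \<in> J \<Longrightarrow> norm (yd i - y i) \<le> \<delta> i"
  shows "prod_norm J (\<lambda>i. yd i - y i) \<le> noise_level J \<delta>"
  unfolding prod_norm_L2 noise_level_L2 using assms by (intro L2_set_mono) auto

text \<open>The constant is the same for all batches; the summand 1 only keeps it positive, so that it may be
  divided by.\<close>

lemma norm_batch_adjoint_le:
  assumes J: "J \<subseteq> {1..p}"
  shows "norm (batch_adjoint A J r) \<le> (1 + (\<Sum>i\<in>{1..p}. norm (A i))) * prod_norm J r"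
proof (rule norm_blinfun_bound)
  have fin: "finite J" using J finite_subset by blast
  show "0 \<le> (1 + (\<Sum>i\<in>{1..p}. norm (A i))) * prod_norm J r"
    by (intro mult_nonneg_nonneg add_nonneg_nonneg sum_nonneg) auto
  fix x
  have "norm (blinfun_apply (batch_adjoint A J r) x) \<le> (\<Sum>i\<in>J. \<bar>r i \<bullet> blinfun_apply (A i) x\<bar>)"
    by (simp add: batch_adjoint_apply prod_inner_def)
  also have "\<dots> \<le> (\<Sum>i\<in>J. norm (A i) * (prod_norm J r * norm x))"
  proof (rule sum_mono)
    fix i assume i: "i \<in> J"
    have "norm (r i) \<le> prod_norm J r"
      unfolding prod_norm_L2 by (rule member_le_L2_set[OF fin i])
    then have "norm (r i) * norm (blinfun_apply (A i) x) \<le> prod_norm J r * (norm (A i) * norm x)"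
      by (intro mult_mono norm_blinfun) auto
    then show "\<bar>r i \<bullet> blinfun_apply (A i) x\<bar> \<le> norm (A i) * (prod_norm J r * norm x)"
      using Cauchy_Schwarz_ineq2[of "r i" "blinfun_apply (A i) x"] by (simp add: mult.left_commute)
  qed
  also have "\<dots> = (\<Sum>i\<in>J. norm (A i)) * (prod_norm J r * norm x)"
    by (simp add: sum_distrib_right)
  also have "\<dots> \<le> (1 + (\<Sum>i\<in>{1..p}. norm (A i))) * (prod_norm J r * norm x)"
    using sum_mono2[OF _ J, of "\<lambda>i. norm (A i)"] by (intro mult_right_mono) (auto intro: add_increasing)
  finally show "norm (blinfun_apply (batch_adjoint A J r) x)
      \<le> (1 + (\<Sum>i\<in>{1..p}. norm (A i))) * prod_norm J r * norm x"
    by (simp add: mult.assoc)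
qed

section \<open>The step size\<close>

context
  fixes \<mu>0 \<mu>1 :: real
  assumes mu_pos: "0 < \<mu>0" "0 < \<mu>1"
begin

lemma step_size_nonneg: "0 \<le> step_size A \<mu>0 \<mu>1 \<tau> \<delta> J r"
  using mu_pos by (auto simp: step_size_def)

lemma step_size_le: "step_size A \<mu>0 \<mu>1 \<tau> \<delta> J r \<le> \<mu>1"
  using mu_pos by (auto simp: step_size_def)

lemma step_size_adjoint_le:
  "step_size A \<mu>0 \<mu>1 \<tau> \<delta> J r * (norm (batch_adjoint A J r))\<^sup>2 \<le> \<mu>0 * (prod_norm J r)\<^sup>2"
proof (cases "norm (batch_adjoint A J r) = 0")
  case False
  let ?g = "(norm (batch_adjoint A J r))\<^sup>2"
  have "step_size A \<mu>0 \<mu>1 \<tau> \<delta> J r \<le> \<mu>0 * (prod_norm J r)\<^sup>2 / ?g"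
    using mu_pos False by (auto simp: step_size_def)
  then have "step_size A \<mu>0 \<mu>1 \<tau> \<delta> J r * ?g \<le> \<mu>0 * (prod_norm J r)\<^sup>2 / ?g * ?g"
    by (rule mult_right_mono) simp
  then show ?thesis using False by simp
qed (use mu_pos in simp)

text \<open>The adjoint is bounded, so without noise the quotient in the step size is bounded below. Both
  sides carry the squared norm because the step vanishes together with the residual.\<close>

lemma step_size_exact_ge:
  assumes "J \<subseteq> {1..p}"
  shows "min (\<mu>0 / (1 + (\<Sum>i\<in>{1..p}. norm (A i)))\<^sup>2) \<mu>1 * (prod_norm J r)\<^sup>2
    \<le> step_size A \<mu>0 \<mu>1 \<tau> (\<lambda>_. 0) J r * (prod_norm J r)\<^sup>2"
proof (cases "prod_norm J r = 0")
  case False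
  let ?L = "1 + (\<Sum>i\<in>{1..p}. norm (A i))"
  let ?g = "norm (batch_adjoint A J r)"
  have r: "0 < prod_norm J r" using False prod_norm_nonneg[of J r] by linarith
  have L: "0 < ?L" by (simp add: add_pos_nonneg sum_nonneg)
  have "min (\<mu>0 / ?L\<^sup>2) \<mu>1 \<le> step_size A \<mu>0 \<mu>1 \<tau> (\<lambda>_. 0) J r"
  proof (cases "?g = 0")
    case True
    then show ?thesis using r by (simp add: step_size_def noise_level_def)
  next
    case g: False
    have "?g\<^sup>2 \<le> (?L * prod_norm J r)\<^sup>2"
      by (intro power_mono norm_batch_adjoint_le[OF assms]) simp
    then have "\<mu>0 * ?g\<^sup>2 \<le> \<mu>0 * (?L\<^sup>2 * (prod_norm J r)\<^sup>2)"
      using mu_pos by (simp add: power_mult_distrib)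
    moreover have "0 < ?L\<^sup>2" "0 < ?g\<^sup>2" using L g by (simp_all del: norm_eq_zero)
    ultimately have "\<mu>0 \<le> \<mu>0 * (?L\<^sup>2 * (prod_norm J r)\<^sup>2) / ?g\<^sup>2"
      by (simp only: pos_le_divide_eq)
    then have "\<mu>0 / ?L\<^sup>2 \<le> \<mu>0 * (?L\<^sup>2 * (prod_norm J r)\<^sup>2) / ?g\<^sup>2 / ?L\<^sup>2"
      by (rule divide_right_mono) simp
    also have "\<dots> = \<mu>0 * (prod_norm J r)\<^sup>2 / ?g\<^sup>2" using L by simp
    finally show ?thesis using r g by (simp add: step_size_def noise_level_def min_le_iff_disj)
  qed
  then show ?thesis by (intro mult_right_mono) auto
qed simp

end

section \<open>The mirror map and the Bregman distance to the solution\<close>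

locale linear_system =
  fixes R :: "'x::banach \<Rightarrow> ereal" and \<sigma> :: real
    and A :: "nat \<Rightarrow> 'x \<Rightarrow>\<^sub>L 'y::real_inner" and y :: "nat \<Rightarrow> 'y" and p :: nat and xdag :: 'x
  assumes proper: "proper R" and lsc: "lower_semicontinuous R"
    and convex: "strongly_convex_with R \<sigma>" and sigma_pos: "0 < \<sigma>"
    and xdag_dom: "xdag \<in> eff_dom R"
    and xdag_solves: "i \<in> {1..p} \<Longrightarrow> blinfun_apply (A i) xdag = y i"
    and xdag_minimal: "(\<And>i. i \<in> {1..p} \<Longrightarrow> blinfun_apply (A i) x = y i) \<Longrightarrow> R xdag \<le> R x"
begin

abbreviation rho :: "'x \<Rightarrow> real" where "rho x \<equiv> real_of_ereal (R x)"

abbreviation X :: "('x \<Rightarrow>\<^sub>L real) \<Rightarrow> 'x" where "X \<equiv> mirror_map R"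

sublocale strongly_convex_lsc "eff_dom R" rho \<sigma>
  by (rule ereal_strongly_convex_lsc[OF proper lsc convex sigma_pos])

lemma dom_finite: "x \<in> eff_dom R \<Longrightarrow> \<exists>a. R x = ereal a"
  using proper by (cases "R x") (auto simp: proper_def eff_dom_def)

lemma ereal_rho: "x \<in> eff_dom R \<Longrightarrow> ereal (rho x) = R x"
  by (fastforce dest: dom_finite)

lemma mirror_map_minimizes:
  shows mirror_map_dom: "X \<xi> \<in> eff_dom R"
    and mirror_map_growth: "z \<in> eff_dom R \<Longrightarrow>
      rho (X \<xi>) - blinfun_apply \<xi> (X \<xi>) + \<sigma> * (norm (z - X \<xi>))\<^sup>2 \<le> rho z - blinfun_apply \<xi> z"
proof -
  interpret S: strongly_convex_lsc "eff_dom R" "\<lambda>x. rho x - blinfun_apply \<xi> x" \<sigma>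
    by (rule subtract_linear)
  let ?F = "\<lambda>x. R x - ereal (blinfun_apply \<xi> x)"
  have F: "?F x = ereal (rho x - blinfun_apply \<xi> x)" if "x \<in> eff_dom R" for x
    using dom_finite[OF that] by auto
  have F_out: "?F x = \<infinity>" if "x \<notin> eff_dom R" for x
    using that by (simp add: eff_dom_def)
  obtain w where w: "w \<in> eff_dom R"
    and w_min: "\<And>z. z \<in> eff_dom R \<Longrightarrow> rho w - blinfun_apply \<xi> w \<le> rho z - blinfun_apply \<xi> z"
    using S.minimizer_exists by blast
  have "?F w \<le> ?F z" for z
    by (cases "z \<in> eff_dom R") (use F w w_min F_out in auto)
  then have "is_arg_min ?F (\<lambda>_. True) w" by (simp add: is_arg_min_linorder)
  then have "is_arg_min ?F (\<lambda>_. True) (X \<xi>)"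
    unfolding mirror_map_def arg_min_def by (rule someI)
  then have least: "?F (X \<xi>) \<le> ?F z" for z by (simp add: is_arg_min_linorder)
  show dom: "X \<xi> \<in> eff_dom R"
    using least[of w] F[OF w] F_out[of "X \<xi>"] by force
  show "rho (X \<xi>) - blinfun_apply \<xi> (X \<xi>) + \<sigma> * (norm (z - X \<xi>))\<^sup>2 \<le> rho z - blinfun_apply \<xi> z"
    if "z \<in> eff_dom R"
  proof (rule S.quadratic_growth[OF dom _ that])
    fix z assume "z \<in> eff_dom R"
    then show "rho (X \<xi>) - blinfun_apply \<xi> (X \<xi>) \<le> rho z - blinfun_apply \<xi> z"
      using least[of z] F[OF dom] F by (metis ereal_less_eq(3))
  qed
qed

text \<open>Each of the two minimizers is inserted into the growth inequality of the other one.\<close>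

lemma mirror_map_Lipschitz: "2 * \<sigma> * norm (X \<eta> - X \<xi>) \<le> norm (\<eta> - \<xi>)"
proof (cases "X \<eta> = X \<xi>")
  case False
  let ?d = "norm (X \<eta> - X \<xi>)"
  have "\<sigma> * ?d\<^sup>2 + \<sigma> * ?d\<^sup>2 \<le> blinfun_apply (\<eta> - \<xi>) (X \<eta> - X \<xi>)"
    using mirror_map_growth[OF mirror_map_dom, of \<xi> \<eta>] mirror_map_growth[OF mirror_map_dom, of \<eta> \<xi>]
    by (simp add: blinfun.diff_left blinfun.diff_right norm_minus_commute)
  also have "\<dots> \<le> norm (\<eta> - \<xi>) * ?d"
    using norm_blinfun[of "\<eta> - \<xi>" "X \<eta> - X \<xi>"] by simp
  finally have "(2 * \<sigma> * ?d) * ?d \<le> norm (\<eta> - \<xi>) * ?d" by (simp add: power2_eq_square)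
  then show ?thesis using False by simp
qed simp

definition gap :: "('x \<Rightarrow>\<^sub>L real) \<Rightarrow> real" where
  "gap \<xi> = rho xdag - rho (X \<xi>) - blinfun_apply \<xi> (xdag - X \<xi>)"

lemma bregman_eq_gap: "real_of_ereal (bregman R \<xi> xdag (X \<xi>)) = gap \<xi>"
  using dom_finite[OF xdag_dom] dom_finite[OF mirror_map_dom[of \<xi>]]
  by (auto simp: bregman_def gap_def)

lemma gap_ge: "\<sigma> * (norm (X \<xi> - xdag))\<^sup>2 \<le> gap \<xi>"
  using mirror_map_growth[OF xdag_dom, of \<xi>]
  by (simp add: gap_def blinfun.diff_right norm_minus_commute)

lemma gap_nonneg: "0 \<le> gap \<xi>"
  by (rule order_trans[OF _ gap_ge]) (use sigma_pos in simp)

text \<open>As a function of \<open>\<xi>\<close>, the gap is the convex conjugate of \<open>R\<close> minus evaluation at \<open>xdag\<close>, up to a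
  constant. Its gradient \<open>X \<xi> - xdag\<close> is Lipschitz with constant \<open>1 / (2 * \<sigma>)\<close>, and this is the
  corresponding descent inequality.\<close>

lemma gap_descent:
  "gap \<eta> \<le> gap \<xi> + blinfun_apply (\<eta> - \<xi>) (X \<xi> - xdag) + (norm (\<eta> - \<xi>))\<^sup>2 / (4 * \<sigma>)"
proof -
  let ?d = "norm (X \<eta> - X \<xi>)" and ?n = "norm (\<eta> - \<xi>)"
  have "gap \<eta> \<le> gap \<xi> + blinfun_apply (\<eta> - \<xi>) (X \<xi> - xdag)
      + blinfun_apply (\<eta> - \<xi>) (X \<eta> - X \<xi>) - \<sigma> * ?d\<^sup>2"
    using mirror_map_growth[OF mirror_map_dom, of \<xi> \<eta>]
    by (simp add: gap_def blinfun.diff_left blinfun.diff_right)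
  moreover have "blinfun_apply (\<eta> - \<xi>) (X \<eta> - X \<xi>) \<le> ?n * ?d"
    using norm_blinfun[of "\<eta> - \<xi>" "X \<eta> - X \<xi>"] by simp
  moreover have "?n * ?d - \<sigma> * ?d\<^sup>2 \<le> ?n\<^sup>2 / (4 * \<sigma>)"
  proof -
    have "0 \<le> \<sigma> * (?d - ?n / (2 * \<sigma>))\<^sup>2" using sigma_pos by simp
    also have "\<dots> = \<sigma> * ?d\<^sup>2 - ?n * ?d + ?n\<^sup>2 / (4 * \<sigma>)"
      using sigma_pos by (simp add: field_simps power2_eq_square)
    finally show ?thesis by simp
  qed
  ultimately show ?thesis by linarith
qed

lemma mirror_map_tendsto:
  assumes "(g \<longlongrightarrow> \<xi>) F"
  shows "((\<lambda>k. X (g k)) \<longlongrightarrow> X \<xi>) F"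
proof -
  have "((\<lambda>k. norm (g k - \<xi>) / (2 * \<sigma>)) \<longlongrightarrow> 0) F"
    using assms sigma_pos by (auto intro!: tendsto_eq_intros)
  moreover have "norm (X (g k) - X \<xi>) \<le> norm (g k - \<xi>) / (2 * \<sigma>)" for k
    using mirror_map_Lipschitz[of "g k" \<xi>] sigma_pos by (simp add: field_simps)
  ultimately have "((\<lambda>k. X (g k) - X \<xi>) \<longlongrightarrow> 0) F"
    by (intro Lim_null_comparison[of "\<lambda>k. X (g k) - X \<xi>"]) auto
  then show ?thesis using LIM_zero_iff by blast
qed

text \<open>The descent inequality, used in both directions, squeezes the gap, which
  avoids any appeal to the behaviour of \<open>R\<close> along \<open>X (g k)\<close>.\<close>

lemma gap_tendsto:
  assumes g: "(g \<longlongrightarrow> \<xi>) F"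
  shows "((\<lambda>k. gap (g k)) \<longlongrightarrow> gap \<xi>) F"
proof (rule tendsto_sandwich)
  show "\<forall>\<^sub>F k in F. gap \<xi> - blinfun_apply (\<xi> - g k) (X (g k) - xdag) - (norm (\<xi> - g k))\<^sup>2 / (4 * \<sigma>)
      \<le> gap (g k)"
  proof (intro always_eventually allI)
    fix k
    show "gap \<xi> - blinfun_apply (\<xi> - g k) (X (g k) - xdag) - (norm (\<xi> - g k))\<^sup>2 / (4 * \<sigma>) \<le> gap (g k)"
      using gap_descent[of \<xi> "g k"] by linarith
  qed
  show "\<forall>\<^sub>F k in F. gap (g k)
      \<le> gap \<xi> + blinfun_apply (g k - \<xi>) (X \<xi> - xdag) + (norm (g k - \<xi>))\<^sup>2 / (4 * \<sigma>)"
    by (intro always_eventually allI gap_descent)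
  have "((\<lambda>k. gap \<xi> - blinfun_apply (\<xi> - g k) (X (g k) - xdag) - (norm (\<xi> - g k))\<^sup>2 / (4 * \<sigma>))
      \<longlongrightarrow> gap \<xi> - blinfun_apply (\<xi> - \<xi>) (X \<xi> - xdag) - (norm (\<xi> - \<xi>))\<^sup>2 / (4 * \<sigma>)) F"
    using sigma_pos by (intro tendsto_intros g mirror_map_tendsto) auto
  then show "((\<lambda>k. gap \<xi> - blinfun_apply (\<xi> - g k) (X (g k) - xdag) - (norm (\<xi> - g k))\<^sup>2 / (4 * \<sigma>))
      \<longlongrightarrow> gap \<xi>) F" by simp
  have "((\<lambda>k. gap \<xi> + blinfun_apply (g k - \<xi>) (X \<xi> - xdag) + (norm (g k - \<xi>))\<^sup>2 / (4 * \<sigma>))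
      \<longlongrightarrow> gap \<xi> + blinfun_apply (\<xi> - \<xi>) (X \<xi> - xdag) + (norm (\<xi> - \<xi>))\<^sup>2 / (4 * \<sigma>)) F"
    using sigma_pos by (intro tendsto_intros g) auto
  then show "((\<lambda>k. gap \<xi> + blinfun_apply (g k - \<xi>) (X \<xi> - xdag) + (norm (g k - \<xi>))\<^sup>2 / (4 * \<sigma>))
      \<longlongrightarrow> gap \<xi>) F" by simp
qed

text \<open>One step is a gradient step for the gap. Pairing the adjoint with \<open>X \<xi> - xdag\<close> gives the squared
  residual up to the noise, which by \<open>active\<close> costs at most the fraction \<open>\<kappa>\<close> of it; the
  second-order term costs at most the fraction \<open>\<mu> / (4 * \<sigma>)\<close>. Noisy data use \<open>\<kappa> = 1 / \<tau>\<close> and exact data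
  \<open>\<kappa> = 0\<close>.\<close>

lemma gap_decrease:
  fixes yd :: "nat \<Rightarrow> 'y"
  defines "r \<equiv> \<lambda>\<xi>. residual A yd (X \<xi>)"
  assumes J: "J \<subseteq> {1..p}" and t: "0 \<le> t"
    and short: "t * (norm (batch_adjoint A J (r \<xi>)))\<^sup>2 \<le> \<mu> * (prod_norm J (r \<xi>))\<^sup>2"
    and active: "t \<noteq> 0 \<Longrightarrow> noise_level J \<delta> \<le> \<kappa> * prod_norm J (r \<xi>)"
    and noise: "\<And>i. i \<in> J \<Longrightarrow> norm (yd i - y i) \<le> \<delta> i"
  shows "gap (\<xi> - t *\<^sub>R batch_adjoint A J (r \<xi>))
    \<le> gap \<xi> - (1 - \<kappa> - \<mu> / (4 * \<sigma>)) * (t * (prod_norm J (r \<xi>))\<^sup>2)"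
proof (cases "t = 0")
  case False
  let ?r = "r \<xi>" and ?d = "\<lambda>i. yd i - y i"
  let ?G = "batch_adjoint A J ?r" and ?n = "prod_norm J (r \<xi>)"
  have "blinfun_apply ?G (X \<xi> - xdag) = prod_inner J ?r (\<lambda>i. ?r i + ?d i)"
    unfolding batch_adjoint_apply prod_inner_def
    by (intro sum.cong refl)
       (use J xdag_solves in \<open>auto simp: r_def residual_def blinfun.diff_right\<close>)
  also have "\<dots> = ?n\<^sup>2 + prod_inner J ?r ?d"
    by (simp add: prod_inner_def inner_add_right sum.distrib flip: prod_inner_self)
  finally have pair: "blinfun_apply ?G (X \<xi> - xdag) = ?n\<^sup>2 + prod_inner J ?r ?d" .
  have "\<bar>prod_inner J ?r ?d\<bar> \<le> ?n * prod_norm J ?d" by (rule prod_inner_Cauchy_Schwarz)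
  also have "\<dots> \<le> ?n * (\<kappa> * ?n)"
    using order_trans[OF prod_norm_le_noise[OF noise] active[OF False]]
    by (intro mult_left_mono) auto
  finally have "(1 - \<kappa>) * ?n\<^sup>2 \<le> blinfun_apply ?G (X \<xi> - xdag)"
    using pair by (simp add: algebra_simps power2_eq_square)
  then have "t * ((1 - \<kappa>) * ?n\<^sup>2) \<le> t * blinfun_apply ?G (X \<xi> - xdag)"
    using t by (rule mult_left_mono)
  moreover have "gap (\<xi> - t *\<^sub>R ?G)
      \<le> gap \<xi> - t * blinfun_apply ?G (X \<xi> - xdag) + t * (t * (norm ?G)\<^sup>2) / (4 * \<sigma>)"
    using gap_descent[of "\<xi> - t *\<^sub>R ?G" \<xi>] t
    by (simp add: blinfun.minus_left blinfun.scaleR_left power_mult_distrib power2_eq_square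
      mult.assoc mult.left_commute)
  moreover have "t * (t * (norm ?G)\<^sup>2) / (4 * \<sigma>) \<le> t * (\<mu> * ?n\<^sup>2) / (4 * \<sigma>)"
    using short t sigma_pos by (intro divide_right_mono mult_left_mono) auto
  ultimately show ?thesis by (simp add: algebra_simps)
qed simp

text \<open>If points with \<open>R x \<le> R xdag - \<eta>\<close> had arbitrarily small misfit, the nested convex sets of such
  points would have a common element: a solution with a smaller value than \<open>xdag\<close>. So those points have
  misfit bounded below, and as \<open>R\<close> is bounded below, a large multiple of the squared misfit
  dominates the defect there. The quadratic form of the bound lets expectations be taken directly.\<close>

lemma near_feasible_value:
  assumes \<eta>: "0 < \<eta>"
  shows "\<exists>C\<ge>0. \<forall>x\<in>eff_dom R. rho xdag - rho x \<le> \<eta> + C * (prod_norm {1..p} (residual A y x))\<^sup>2"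
proof -
  define e where "e = (\<lambda>x. prod_norm {1..p} (residual A y x))"
  define E where "E = (\<lambda>k::nat. {x\<in>eff_dom R. rho x \<le> rho xdag - \<eta>} \<inter>
      (\<Inter>i\<in>{1..p}. (\<lambda>x. blinfun_apply (A i) x) -` cball (y i) (1 / real (Suc k))))"
  have "\<exists>k. E k = {}"
  proof (rule ccontr)
    assume ne: "\<not> (\<exists>k. E k = {})"
    have "\<exists>x. \<forall>k. x \<in> E k"
    proof (rule nested_convex_sets_meet)
      show "E k \<subseteq> {x\<in>eff_dom R. rho x \<le> rho xdag - \<eta>}" for k by (auto simp: E_def)
      show "E k \<noteq> {}" for k using ne by blast
      show "convex (E k)" for k
        unfolding E_def
        by (intro convex_Int sublevel_convex convex_INT convex_linear_vimage convex_cball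
            bounded_linear.linear[OF blinfun.bounded_linear_right])
      show "closed (E k)" for k
        unfolding E_def
        by (intro closed_Int sublevel_closed closed_INT ballI closed_vimage closed_cball
            linear_continuous_on blinfun.bounded_linear_right)
      show "decseq E"
      proof (rule decseq_SucI)
        fix k
        have "1 / real (Suc (Suc k)) \<le> 1 / real (Suc k)" by (simp add: frac_le)
        then show "E (Suc k) \<subseteq> E k"
          unfolding E_def by (intro Int_mono INF_mono' vimage_mono subset_cball order_refl)
      qed
    qed
    then obtain x where x: "\<And>k. x \<in> E k" by blast
    have "blinfun_apply (A i) x = y i" if i: "i \<in> {1..p}" for i
    proof -
      have "dist (y i) (blinfun_apply (A i) x) \<le> inverse (real (Suc k))" for k
        using x[of k] i by (simp add: E_def inverse_eq_divide)
      then have "dist (y i) (blinfun_apply (A i) x) \<le> 0"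
        by (intro LIMSEQ_le_const[OF LIMSEQ_inverse_real_of_nat]) auto
      then show ?thesis by simp
    qed
    then have "R xdag \<le> R x" by (rule xdag_minimal)
    moreover have "x \<in> eff_dom R" "rho x \<le> rho xdag - \<eta>" using x[of 0] by (auto simp: E_def)
    ultimately have "ereal (rho xdag) \<le> ereal (rho x)"
      using ereal_rho xdag_dom by simp
    then show False using \<eta> \<open>rho x \<le> rho xdag - \<eta>\<close> by simp
  qed
  then obtain k where k: "E k = {}" by blast
  obtain m where m: "\<And>x. x \<in> eff_dom R \<Longrightarrow> m \<le> rho x" using bounded_below by blast
  define C where "C = (rho xdag - m) * (real (Suc k))\<^sup>2"
  have C0: "0 \<le> C" using m[OF xdag_dom] by (simp add: C_def)
  have "rho xdag - rho x \<le> \<eta> + C * (e x)\<^sup>2" if x: "x \<in> eff_dom R" for x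
  proof (cases "rho x \<le> rho xdag - \<eta>")
    case False
    moreover have "0 \<le> C * (e x)\<^sup>2" using C0 by simp
    ultimately show ?thesis by linarith
  next
    case True
    have "x \<notin> E k" using k by simp
    then obtain i where i: "i \<in> {1..p}" "\<not> dist (y i) (blinfun_apply (A i) x) \<le> 1 / real (Suc k)"
      using True x unfolding E_def by (simp only: Int_iff mem_Collect_eq INT_iff vimage_eq mem_cball) blast
    have "dist (y i) (blinfun_apply (A i) x) = norm (residual A y x i)"
      by (simp add: residual_def dist_norm norm_minus_commute)
    also have "\<dots> \<le> e x"
      unfolding e_def prod_norm_L2 using i by (intro member_le_L2_set) auto
    finally have "1 / real (Suc k) \<le> e x" using i by simp
    then have "1 \<le> real (Suc k) * e x" by (simp add: field_simps)
    then have "1 \<le> (real (Suc k) * e x)\<^sup>2" by simp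
    then have "(rho xdag - m) * 1 \<le> (rho xdag - m) * (real (Suc k) * e x)\<^sup>2"
      using m[OF xdag_dom] by (intro mult_left_mono) auto
    then show ?thesis using m[OF x] \<eta> by (simp add: C_def power_mult_distrib mult.assoc)
  qed
  then show ?thesis using C0 by (auto simp: e_def)
qed

end


section \<open>The iterates along a fixed sequence of batches\<close>

lemma batch_adjoint_diff:
  "batch_adjoint A J u - batch_adjoint A J v = batch_adjoint A J (\<lambda>i. u i - v i)"
  by (rule blinfun_eqI)
     (simp add: blinfun.diff_left batch_adjoint_apply prod_inner_def inner_diff_left sum_subtractf)

lemma prod_norm_tendsto:
  assumes "\<And>i. i \<in> J \<Longrightarrow> ((\<lambda>k. r k i) \<longlongrightarrow> s i) F"
  shows "((\<lambda>k. prod_norm J (r k)) \<longlongrightarrow> prod_norm J s) F"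
  unfolding prod_norm_def prod_inner_def using assms by (intro tendsto_intros) auto

lemma batch_adjoint_tendsto:
  assumes J: "J \<subseteq> {1..p}" and r: "\<And>i. i \<in> J \<Longrightarrow> ((\<lambda>k. r k i) \<longlongrightarrow> s i) F"
  shows "((\<lambda>k. batch_adjoint A J (r k)) \<longlongrightarrow> batch_adjoint A J s) F"
proof -
  have "((\<lambda>k. prod_norm J (\<lambda>i. r k i - s i)) \<longlongrightarrow> prod_norm J (\<lambda>i. s i - s i)) F"
    using r by (intro prod_norm_tendsto tendsto_diff tendsto_const)
  then have "((\<lambda>k. (1 + (\<Sum>i\<in>{1..p}. norm (A i))) * prod_norm J (\<lambda>i. r k i - s i)) \<longlongrightarrow> 0) F"
    by (intro tendsto_mult_right_zero) (simp add: prod_norm_def prod_inner_def)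
  then have "((\<lambda>k. batch_adjoint A J (r k) - batch_adjoint A J s) \<longlongrightarrow> 0) F"
    unfolding batch_adjoint_diff
    by (rule Lim_null_comparison[rotated]) (intro always_eventually allI norm_batch_adjoint_le[OF J])
  then show ?thesis by (rule LIM_zero_cancel)
qed

locale mirror_descent = linear_system R \<sigma> A y p xdag
  for R :: "'x::banach \<Rightarrow> ereal" and \<sigma> :: real
    and A :: "nat \<Rightarrow> 'x \<Rightarrow>\<^sub>L 'y::real_inner" and y :: "nat \<Rightarrow> 'y" and p :: nat and xdag :: 'x +
  fixes \<mu>0 \<mu>1 \<tau> :: real
  assumes mu0_pos: "0 < \<mu>0" and mu1_pos: "0 < \<mu>1"
    and mu0_less: "\<mu>0 < 4 * \<sigma>" and tau_gt: "1 < \<tau>"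
    and margin: "0 \<le> 1 - 1 / \<tau> - \<mu>0 / (4 * \<sigma>)"
begin

abbreviation dual :: "(nat \<Rightarrow> real) \<Rightarrow> (nat \<Rightarrow> 'y) \<Rightarrow> (nat \<Rightarrow> nat set) \<Rightarrow> nat \<Rightarrow> 'x \<Rightarrow>\<^sub>L real" where
  "dual \<delta> yd \<equiv> smd_dual R A \<mu>0 \<mu>1 \<tau> \<delta> yd"

abbreviation exact :: "(nat \<Rightarrow> nat set) \<Rightarrow> nat \<Rightarrow> 'x \<Rightarrow>\<^sub>L real" where
  "exact \<equiv> dual (\<lambda>_. 0) y"

abbreviation misfit :: "'x \<Rightarrow> real" where
  "misfit x \<equiv> prod_norm {1..p} (residual A y x)"

abbreviation step :: "(nat \<Rightarrow> real) \<Rightarrow> nat set \<Rightarrow> (nat \<Rightarrow> 'y) \<Rightarrow> real" where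
  "step \<equiv> step_size A \<mu>0 \<mu>1 \<tau>"

lemma dual_local: "(\<And>m. m < n \<Longrightarrow> J m = J' m) \<Longrightarrow> dual \<delta> yd J n = dual \<delta> yd J' n"
  by (induction n) (simp_all add: Let_def)

lemma gap_dual_Suc_le:
  assumes J: "J n \<subseteq> {1..p}"
    and noise: "\<And>i. i \<in> {1..p} \<Longrightarrow> norm (yd i - y i) \<le> \<delta> i"
  shows "gap (dual \<delta> yd J (Suc n)) \<le> gap (dual \<delta> yd J n)"
proof -
  let ?r = "residual A yd (X (dual \<delta> yd J n))"
  let ?t = "step \<delta> (J n) ?r"
  have t: "0 \<le> ?t" using mu0_pos mu1_pos by (rule step_size_nonneg)
  have "gap (dual \<delta> yd J (Suc n))
      \<le> gap (dual \<delta> yd J n) - (1 - 1 / \<tau> - \<mu>0 / (4 * \<sigma>)) * (?t * (prod_norm (J n) ?r)\<^sup>2)"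
    unfolding smd_dual.simps Let_def
  proof (rule gap_decrease[OF J t, where \<delta> = \<delta>])
    show "?t * (norm (batch_adjoint A (J n) ?r))\<^sup>2 \<le> \<mu>0 * (prod_norm (J n) ?r)\<^sup>2"
      using mu0_pos mu1_pos by (rule step_size_adjoint_le)
    show "noise_level (J n) \<delta> \<le> 1 / \<tau> * prod_norm (J n) ?r" if "?t \<noteq> 0"
    proof -
      have "\<tau> * noise_level (J n) \<delta> < prod_norm (J n) ?r"
        using that by (auto simp: step_size_def split: if_splits)
      then show ?thesis using tau_gt by (simp add: field_simps)
    qed
    show "norm (yd i - y i) \<le> \<delta> i" if "i \<in> J n" for i
      using J noise that by blast
  qed
  moreover have "0 \<le> (1 - 1 / \<tau> - \<mu>0 / (4 * \<sigma>)) * (?t * (prod_norm (J n) ?r)\<^sup>2)"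
    using t margin by simp
  ultimately show ?thesis by linarith
qed

lemma gap_exact_decrease:
  obtains c where "0 < c"
    "\<And>J n. J n \<subseteq> {1..p} \<Longrightarrow> gap (exact J (Suc n))
      \<le> gap (exact J n) - c * (prod_norm (J n) (residual A y (X (exact J n))))\<^sup>2"
proof
  let ?low = "min (\<mu>0 / (1 + (\<Sum>i\<in>{1..p}. norm (A i)))\<^sup>2) \<mu>1"
  let ?c = "(1 - \<mu>0 / (4 * \<sigma>)) * ?low"
  have c1: "0 < 1 - \<mu>0 / (4 * \<sigma>)" using mu0_less sigma_pos by (simp add: field_simps)
  have "0 < 1 + (\<Sum>i\<in>{1..p}. norm (A i))" by (simp add: add_pos_nonneg sum_nonneg)
  then show "0 < ?c" using c1 mu0_pos mu1_pos by simp
  fix J and n :: nat assume J: "J n \<subseteq> {1..p}"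
  let ?r = "residual A y (X (exact J n))"
  let ?t = "step (\<lambda>_. 0) (J n) ?r"
  have "gap (exact J (Suc n))
      \<le> gap (exact J n) - (1 - 0 - \<mu>0 / (4 * \<sigma>)) * (?t * (prod_norm (J n) ?r)\<^sup>2)"
    unfolding smd_dual.simps Let_def
  proof (rule gap_decrease[OF J, where \<delta> = "\<lambda>_. 0"])
    show "0 \<le> ?t" using mu0_pos mu1_pos by (rule step_size_nonneg)
    show "?t * (norm (batch_adjoint A (J n) ?r))\<^sup>2 \<le> \<mu>0 * (prod_norm (J n) ?r)\<^sup>2"
      using mu0_pos mu1_pos by (rule step_size_adjoint_le)
  qed (simp_all add: noise_level_def)
  also have "\<dots> \<le> gap (exact J n) - (1 - 0 - \<mu>0 / (4 * \<sigma>)) * (?low * (prod_norm (J n) ?r)\<^sup>2)"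
    using c1 by (intro diff_left_mono mult_left_mono[OF step_size_exact_ge[OF mu0_pos mu1_pos J]]) simp
  finally show "gap (exact J (Suc n)) \<le> gap (exact J n) - ?c * (prod_norm (J n) ?r)\<^sup>2"
    by (simp add: mult.assoc)
qed

text \<open>Starting from 0, the exact dual iterate is a combination of adjoints applied to earlier residuals.
  Moving each adjoint to the other side turns \<open>x - xdag\<close> into the residual of \<open>x\<close>.\<close>

lemma exact_pairing_le:
  assumes "\<And>m. m < n \<Longrightarrow> J m \<subseteq> {1..p}"
  shows "blinfun_apply (exact J n) (x - xdag)
    \<le> \<mu>1 * (\<Sum>m<n. misfit (X (exact J m)) * misfit x)"
  using assms
proof (induction n)
  case (Suc n)
  let ?r = "residual A y (X (exact J n))" and ?s = "residual A y x"
  let ?t = "step (\<lambda>_. 0) (J n) ?r"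
  have J: "J n \<subseteq> {1..p}" using Suc.prems by blast
  have "blinfun_apply (batch_adjoint A (J n) ?r) (x - xdag) = prod_inner (J n) ?r ?s"
    unfolding batch_adjoint_apply prod_inner_def
    by (intro sum.cong refl) (use J xdag_solves in \<open>auto simp: residual_def blinfun.diff_right\<close>)
  moreover have "\<bar>prod_inner (J n) ?r ?s\<bar> \<le> prod_norm (J n) ?r * prod_norm (J n) ?s"
    by (rule prod_inner_Cauchy_Schwarz)
  moreover have "\<dots> \<le> prod_norm {1..p} ?r * prod_norm {1..p} ?s"
    using J by (intro mult_mono prod_norm_mono) auto
  ultimately have pair: "- blinfun_apply (batch_adjoint A (J n) ?r) (x - xdag)
      \<le> prod_norm {1..p} ?r * prod_norm {1..p} ?s" by linarith
  have "?t * - blinfun_apply (batch_adjoint A (J n) ?r) (x - xdag)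
      \<le> ?t * (prod_norm {1..p} ?r * prod_norm {1..p} ?s)"
    using pair by (rule mult_left_mono) (rule step_size_nonneg[OF mu0_pos mu1_pos])
  also have "\<dots> \<le> \<mu>1 * (prod_norm {1..p} ?r * prod_norm {1..p} ?s)"
    by (rule mult_right_mono) (auto intro: step_size_le[OF mu0_pos mu1_pos])
  finally have "blinfun_apply (exact J (Suc n)) (x - xdag)
      \<le> blinfun_apply (exact J n) (x - xdag) + \<mu>1 * (prod_norm {1..p} ?r * prod_norm {1..p} ?s)"
    by (simp add: Let_def blinfun.diff_left blinfun.scaleR_left)
  then show ?case using Suc by (simp add: distrib_left)
qed simp

lemma gap_exact_le:
  assumes \<eta>: "0 < \<eta>"
  shows "\<exists>C\<ge>0. \<forall>J n. (\<forall>m<n. J m \<subseteq> {1..p}) \<longrightarrow> gap (exact J n)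
    \<le> \<eta> + C * (misfit (X (exact J n)))\<^sup>2
      + \<mu>1 * (\<Sum>m<n. misfit (X (exact J m)) * misfit (X (exact J n)))"
proof -
  obtain C where C: "0 \<le> C"
    "\<And>x. x \<in> eff_dom R \<Longrightarrow> rho xdag - rho x \<le> \<eta> + C * (misfit x)\<^sup>2"
    using near_feasible_value[OF \<eta>] by blast
  have "gap (exact J n) \<le> \<eta> + C * (misfit (X (exact J n)))\<^sup>2
      + \<mu>1 * (\<Sum>m<n. misfit (X (exact J m)) * misfit (X (exact J n)))"
    if J: "\<forall>m<n. J m \<subseteq> {1..p}" for J n
  proof -
    have "gap (exact J n) = rho xdag - rho (X (exact J n))
        + blinfun_apply (exact J n) (X (exact J n) - xdag)"
      by (simp add: gap_def blinfun.diff_right)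
    then show ?thesis
      using C(2)[OF mirror_map_dom, of "exact J n"] exact_pairing_le[of n J "X (exact J n)"] J
      by simp
  qed
  then show ?thesis using C(1) by blast
qed

text \<open>The step size itself is not continuous: it jumps where the exact residual vanishes. There, however,
  the adjoint of the residual vanishes too and the step size is bounded, so the update still converges.
  Where the residual does not vanish, the discrepancy test is eventually passed and the adjoint is
  nonzero, so the quotient is continuous.\<close>

lemma dual_tendsto_exact:
  assumes \<delta>: "\<And>i. i \<in> {1..p} \<Longrightarrow> ((\<lambda>k. \<delta> k i) \<longlongrightarrow> 0) F"
    and yd: "\<And>i. i \<in> {1..p} \<Longrightarrow> ((\<lambda>k. yd k i) \<longlongrightarrow> y i) F"
    and J: "\<And>m. m < n \<Longrightarrow> J m \<subseteq> {1..p}"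
  shows "((\<lambda>k. dual (\<delta> k) (yd k) J n) \<longlongrightarrow> exact J n) F"
  using J
proof (induction n)
  case (Suc n)
  let ?B = "J n" and ?\<xi> = "\<lambda>k. dual (\<delta> k) (yd k) J n"
  let ?r = "\<lambda>k. residual A (yd k) (X (?\<xi> k))" and ?s = "residual A y (X (exact J n))"
  have B: "?B \<subseteq> {1..p}" using Suc.prems by blast
  have \<xi>: "(?\<xi> \<longlongrightarrow> exact J n) F" using Suc by simp
  have r: "((\<lambda>k. ?r k i) \<longlongrightarrow> ?s i) F" if "i \<in> ?B" for i
    unfolding residual_def
    using B that by (intro tendsto_intros mirror_map_tendsto[OF \<xi>] yd) auto
  have nr: "((\<lambda>k. prod_norm ?B (?r k)) \<longlongrightarrow> prod_norm ?B ?s) F"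
    using r by (rule prod_norm_tendsto)
  have ar: "((\<lambda>k. batch_adjoint A ?B (?r k)) \<longlongrightarrow> batch_adjoint A ?B ?s) F"
    using B r by (rule batch_adjoint_tendsto)
  have "((\<lambda>k. step (\<delta> k) ?B (?r k) *\<^sub>R batch_adjoint A ?B (?r k)) \<longlongrightarrow>
      step (\<lambda>_. 0) ?B ?s *\<^sub>R batch_adjoint A ?B ?s) F"
  proof (cases "prod_norm ?B ?s = 0")
    case True
    then have "norm (batch_adjoint A ?B ?s) \<le> 0"
      using norm_batch_adjoint_le[OF B, of A ?s] by simp
    then have zero: "batch_adjoint A ?B ?s = 0" by simp
    have "((\<lambda>k. \<mu>1 * norm (batch_adjoint A ?B (?r k))) \<longlongrightarrow> 0) F"
      by (intro tendsto_mult_right_zero tendsto_norm_zero) (use ar zero in simp)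
    then have "((\<lambda>k. step (\<delta> k) ?B (?r k) *\<^sub>R batch_adjoint A ?B (?r k)) \<longlongrightarrow> 0) F"
      by (rule Lim_null_comparison[rotated])
         (auto intro!: always_eventually mult_right_mono step_size_le
           simp: step_size_nonneg mu0_pos mu1_pos)
    then show ?thesis by (simp add: zero)
  next
    case False
    have pos: "0 < prod_norm ?B ?s" using False prod_norm_nonneg[of ?B ?s] by linarith
    \<comment> \<open>The residual is the image of \<open>X \<xi> - xdag\<close>, so the adjoint of the residual paired with that
      vector is the squared norm of the residual.\<close>
    have adj: "batch_adjoint A ?B ?s \<noteq> 0"
    proof
      assume 0: "batch_adjoint A ?B ?s = 0"
      have "(prod_norm ?B ?s)\<^sup>2 = blinfun_apply (batch_adjoint A ?B ?s) (X (exact J n) - xdag)"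
        unfolding prod_inner_self[symmetric] batch_adjoint_apply prod_inner_def
        by (intro sum.cong refl) (use B xdag_solves in \<open>auto simp: residual_def blinfun.diff_right\<close>)
      then show False using 0 pos by simp
    qed
    have "((\<lambda>k. \<tau> * noise_level ?B (\<delta> k)) \<longlongrightarrow> \<tau> * sqrt (\<Sum>i\<in>?B. 0\<^sup>2)) F"
      unfolding noise_level_def using B by (intro tendsto_intros \<delta>) auto
    then have d0: "((\<lambda>k. prod_norm ?B (?r k) - \<tau> * noise_level ?B (\<delta> k)) \<longlongrightarrow> prod_norm ?B ?s) F"
      using tendsto_diff[OF nr] by fastforce
    have e1: "\<forall>\<^sub>F k in F. 0 < prod_norm ?B (?r k) - \<tau> * noise_level ?B (\<delta> k)"
      by (rule order_tendstoD(1)[OF d0 pos])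
    have e2: "\<forall>\<^sub>F k in F. batch_adjoint A ?B (?r k) \<noteq> 0"
      by (rule tendsto_imp_eventually_ne[OF ar adj])
    have lim: "((\<lambda>k. min (\<mu>0 * (prod_norm ?B (?r k))\<^sup>2 / (norm (batch_adjoint A ?B (?r k)))\<^sup>2) \<mu>1
          *\<^sub>R batch_adjoint A ?B (?r k)) \<longlongrightarrow>
        min (\<mu>0 * (prod_norm ?B ?s)\<^sup>2 / (norm (batch_adjoint A ?B ?s))\<^sup>2) \<mu>1
          *\<^sub>R batch_adjoint A ?B ?s) F"
      using adj by (intro tendsto_intros nr ar) auto
    have "((\<lambda>k. step (\<delta> k) ?B (?r k) *\<^sub>R batch_adjoint A ?B (?r k)) \<longlongrightarrow>
        min (\<mu>0 * (prod_norm ?B ?s)\<^sup>2 / (norm (batch_adjoint A ?B ?s))\<^sup>2) \<mu>1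
          *\<^sub>R batch_adjoint A ?B ?s) F"
    proof (rule Lim_transform_eventually[OF lim])
      show "\<forall>\<^sub>F k in F. min (\<mu>0 * (prod_norm ?B (?r k))\<^sup>2 / (norm (batch_adjoint A ?B (?r k)))\<^sup>2) \<mu>1
          *\<^sub>R batch_adjoint A ?B (?r k) = step (\<delta> k) ?B (?r k) *\<^sub>R batch_adjoint A ?B (?r k)"
        using e1 e2 by eventually_elim (simp add: step_size_def)
    qed
    moreover have "step (\<lambda>_. 0) ?B ?s
        = min (\<mu>0 * (prod_norm ?B ?s)\<^sup>2 / (norm (batch_adjoint A ?B ?s))\<^sup>2) \<mu>1"
      using pos adj by (simp add: step_size_def noise_level_def)
    ultimately show ?thesis by simp
  qed
  then show ?case unfolding smd_dual.simps Let_def by (intro tendsto_diff \<xi>)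
qed simp

end

section \<open>Expectations over independent uniform batches\<close>

lemma batches_finite [simp]: "finite (batches p b)"
  unfolding batches_def by (rule finite_subset[of _ "Pow {1..p}"]) auto

locale uniform_batches = prob_space M
  for M :: "'w measure" +
  fixes p b :: nat and I :: "nat \<Rightarrow> 'w \<Rightarrow> nat set"
  assumes batch_size: "b \<in> {1..p}" and iid: "iid_uniform_batches M p b I"
begin

text \<open>Functions of the first \<open>n\<close> batches take finitely many values, so their expectations are finite
  averages over batch sequences. Sequences in \<open>paths n\<close> are undefined from index \<open>n\<close> on, which such
  functions cannot see.\<close>

definition determined_by :: "nat \<Rightarrow> ((nat \<Rightarrow> nat set) \<Rightarrow> real) \<Rightarrow> bool" where
  "determined_by n f \<longleftrightarrow> (\<forall>J J'. (\<forall>m<n. J m = J' m) \<longrightarrow> f J = f J')"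

lemma determined_byI:
  "(\<And>J J'. (\<And>m. m < n \<Longrightarrow> J m = J' m) \<Longrightarrow> f J = f J') \<Longrightarrow> determined_by n f"
  unfolding determined_by_def by blast

lemma determined_byD: "determined_by n f \<Longrightarrow> (\<And>m. m < n \<Longrightarrow> J m = J' m) \<Longrightarrow> f J = f J'"
  unfolding determined_by_def by blast

definition cylinder :: "nat \<Rightarrow> (nat \<Rightarrow> nat set) \<Rightarrow> 'w set" where
  "cylinder n K = {\<omega>\<in>space M. \<forall>m<n. I m \<omega> = K m}"

abbreviation paths :: "nat \<Rightarrow> (nat \<Rightarrow> nat set) set" where
  "paths n \<equiv> PiE {..<n} (\<lambda>_. batches p b)"

lemma batch_exists: "i \<in> {1..p} \<Longrightarrow> \<exists>S\<in>batches p b. i \<in> S"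
proof -
  assume i: "i \<in> {1..p}"
  have "b - 1 \<le> card ({1..p} - {i})" using i batch_size by auto
  then obtain T where T: "T \<subseteq> {1..p} - {i}" "card T = b - 1" "finite T"
    by (rule obtain_subset_with_card_n)
  then have "card (insert i T) = b" using batch_size by (subst card_insert_disjoint) auto
  then show ?thesis using T i by (intro bexI[of _ "insert i T"]) (auto simp: batches_def)
qed

lemma card_batches_pos: "0 < card (batches p b)"
  using batch_exists[of 1] batch_size by (auto simp: card_gt_0_iff)

lemma I_measurable: "I m \<in> measurable M (count_space (batches p b))"
  using iid by (simp add: iid_uniform_batches_def indep_vars_def2)

lemma I_batch: "\<omega> \<in> space M \<Longrightarrow> I m \<omega> \<in> batches p b"
  using measurable_space[OF I_measurable] by simp

lemma I_subset: "\<omega> \<in> space M \<Longrightarrow> I m \<omega> \<subseteq> {1..p}"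
  using I_batch[of \<omega> m] by (simp add: batches_def)

lemma prob_batch: "S \<in> batches p b \<Longrightarrow> prob (I m -` {S} \<inter> space M) = 1 / card (batches p b)"
proof -
  assume S: "S \<in> batches p b"
  have "prob (I m -` {S} \<inter> space M) = measure (distr M (count_space (batches p b)) (I m)) {S}"
    using S by (simp add: measure_distr[OF I_measurable])
  also have "\<dots> = measure (uniform_count_measure (batches p b)) {S}"
    using iid by (simp add: iid_uniform_batches_def)
  also have "\<dots> = 1 / card (batches p b)"
    using S by (simp add: measure_uniform_count_measure)
  finally show ?thesis .
qed

lemma cylinder_subset: "cylinder n K \<subseteq> space M"
  by (auto simp: cylinder_def)

lemma cylinder_eq: "0 < n \<Longrightarrow> cylinder n K = (\<Inter>m\<in>{..<n}. I m -` {K m} \<inter> space M)"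
  by (auto simp: cylinder_def)

lemma cylinder_measurable:
  assumes "\<And>m. m < n \<Longrightarrow> K m \<in> batches p b"
  shows "cylinder n K \<in> sets M"
proof (cases "n = 0")
  case True
  then show ?thesis by (simp add: cylinder_def)
next
  case False
  have "I m -` {K m} \<inter> space M \<in> sets M" if "m < n" for m
    using assms[OF that] by (intro measurable_sets[OF I_measurable]) auto
  then have "(\<Inter>m\<in>{..<n}. I m -` {K m} \<inter> space M) \<in> sets M"
    using False by (intro sets.finite_INT) auto
  then show ?thesis using False by (simp add: cylinder_eq)
qed

lemma prob_cylinder:
  assumes "\<And>m. m < n \<Longrightarrow> K m \<in> batches p b"
  shows "prob (cylinder n K) = (1 / card (batches p b)) ^ n"
proof (cases "n = 0")
  case True
  then show ?thesis by (simp add: cylinder_def prob_space)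
next
  case False
  have "prob (\<Inter>m\<in>{..<n}. I m -` {K m} \<inter> space M) = (\<Prod>m\<in>{..<n}. prob (I m -` {K m} \<inter> space M))"
    using iid False assms
    by (intro indep_varsD[where M' = "\<lambda>_. count_space (batches p b)" and I = UNIV])
       (auto simp: iid_uniform_batches_def)
  also have "\<dots> = (1 / card (batches p b)) ^ n"
    using assms by (simp add: prob_batch)
  finally show ?thesis using False by (simp add: cylinder_eq)
qed

lemma determined_expansion:
  assumes f: "determined_by n f" and \<omega>: "\<omega> \<in> space M"
  shows "f (\<lambda>m. I m \<omega>) = (\<Sum>K\<in>paths n. f K * indicator (cylinder n K) \<omega>)"
proof -
  let ?K = "restrict (\<lambda>m. I m \<omega>) {..<n}"
  have "(\<Sum>K\<in>paths n. f K * indicator (cylinder n K) \<omega>) = (\<Sum>K\<in>paths n. if ?K = K then f K else 0)"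
  proof (rule sum.cong[OF refl])
    fix K assume K: "K \<in> paths n"
    have "\<omega> \<in> cylinder n K \<longleftrightarrow> ?K = K"
      using \<omega> K by (auto simp: cylinder_def PiE_def extensional_def restrict_def fun_eq_iff)
    then show "f K * indicator (cylinder n K) \<omega> = (if ?K = K then f K else 0)"
      by (simp add: indicator_def)
  qed
  also have "\<dots> = f ?K"
  proof -
    have "?K \<in> paths n" using I_batch[OF \<omega>] by simp
    moreover have "finite (paths n)" by (simp add: finite_PiE)
    ultimately show ?thesis by (subst sum.delta') auto
  qed
  also have "\<dots> = f (\<lambda>m. I m \<omega>)"
    by (rule determined_byD[OF f]) simp
  finally show ?thesis by simp
qed

lemma determined_integrable:
  assumes "determined_by n f"
  shows "integrable M (\<lambda>\<omega>. f (\<lambda>m. I m \<omega>))"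
proof -
  have "integrable M (\<lambda>\<omega>. \<Sum>K\<in>paths n. f K * indicator (cylinder n K) \<omega>)"
    by (intro Bochner_Integration.integrable_sum integrable_mult_right integrable_real_indicator
        cylinder_measurable) (auto simp: emeasure_eq_measure)
  also have "?this \<longleftrightarrow> ?thesis"
    by (intro Bochner_Integration.integrable_cong refl determined_expansion[OF assms, symmetric])
  finally show ?thesis .
qed

lemma determined_expectation:
  assumes "determined_by n f"
  shows "expectation (\<lambda>\<omega>. f (\<lambda>m. I m \<omega>)) = (\<Sum>K\<in>paths n. f K * (1 / card (batches p b)) ^ n)"
proof -
  have "expectation (\<lambda>\<omega>. f (\<lambda>m. I m \<omega>))
      = expectation (\<lambda>\<omega>. \<Sum>K\<in>paths n. f K * indicator (cylinder n K) \<omega>)"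
    by (intro Bochner_Integration.integral_cong refl determined_expansion[OF assms])
  also have "\<dots> = (\<Sum>K\<in>paths n. expectation (\<lambda>\<omega>. f K * indicator (cylinder n K) \<omega>))"
    by (intro Bochner_Integration.integral_sum integrable_mult_right integrable_real_indicator
        cylinder_measurable) (auto simp: emeasure_eq_measure)
  also have "\<dots> = (\<Sum>K\<in>paths n. f K * prob (cylinder n K))"
    by (simp add: Int_absorb2 cylinder_subset)
  also have "\<dots> = (\<Sum>K\<in>paths n. f K * (1 / card (batches p b)) ^ n)"
    by (intro sum.cong refl) (simp add: prob_cylinder PiE_def Pi_def)
  finally show ?thesis .
qed

text \<open>Independence in the form in which the method uses it: the next batch may be averaged out while the
  past is kept.\<close>

lemma expectation_fresh_batch:
  assumes h: "\<And>S. determined_by n (h S)"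
  shows "expectation (\<lambda>\<omega>. h (I n \<omega>) (\<lambda>m. I m \<omega>))
    = (\<Sum>S\<in>batches p b. expectation (\<lambda>\<omega>. h S (\<lambda>m. I m \<omega>))) / card (batches p b)"
proof -
  let ?q = "1 / real (card (batches p b))"
  have fresh: "determined_by (Suc n) (\<lambda>J. h (J n) J)"
  proof (rule determined_byI)
    fix J J' :: "nat \<Rightarrow> nat set" assume J: "\<And>m. m < Suc n \<Longrightarrow> J m = J' m"
    have "h (J n) J = h (J n) J'" by (rule determined_byD[OF h]) (simp add: J)
    then show "h (J n) J = h (J' n) J'" using J by simp
  qed
  have dis: "n \<notin> {..<n}" by simp
  have "expectation (\<lambda>\<omega>. h (I n \<omega>) (\<lambda>m. I m \<omega>)) = (\<Sum>K\<in>paths (Suc n). h (K n) K * ?q ^ Suc n)"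
    using determined_expectation[OF fresh] by simp
  also have "paths (Suc n) = (\<lambda>(S, K). K(n := S)) ` (batches p b \<times> paths n)"
    unfolding lessThan_Suc by (rule PiE_insert_eq)
  also have "(\<Sum>K\<in>(\<lambda>(S, K). K(n := S)) ` (batches p b \<times> paths n). h (K n) K * ?q ^ Suc n)
      = (\<Sum>(S, K)\<in>batches p b \<times> paths n. h S (K(n := S)) * ?q ^ Suc n)"
    by (subst sum.reindex[OF inj_combinator[OF dis]]) (simp add: case_prod_unfold)
  also have "\<dots> = (\<Sum>S\<in>batches p b. \<Sum>K\<in>paths n. h S K * ?q ^ Suc n)"
    unfolding sum.cartesian_product[symmetric]
  proof (intro sum.cong refl)
    fix S K
    have "h S (K(n := S)) = h S K" by (rule determined_byD[OF h]) simp
    then show "h S (K(n := S)) * ?q ^ Suc n = h S K * ?q ^ Suc n" by simp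
  qed
  also have "\<dots> = (\<Sum>S\<in>batches p b. ?q * expectation (\<lambda>\<omega>. h S (\<lambda>m. I m \<omega>)))"
    by (intro sum.cong refl) (simp add: determined_expectation[OF h] sum_distrib_left mult_ac)
  also have "\<dots> = (\<Sum>S\<in>batches p b. expectation (\<lambda>\<omega>. h S (\<lambda>m. I m \<omega>))) / card (batches p b)"
    by (simp add: sum_divide_distrib)
  finally show ?thesis .
qed

text \<open>The Cauchy-Schwarz inequality for the finite average over paths, with the weight of each path split
  evenly between the two factors.\<close>

lemma expectation_mult_le_sqrt:
  assumes f: "determined_by n f" and g: "determined_by n g"
  shows "expectation (\<lambda>\<omega>. f (\<lambda>m. I m \<omega>) * g (\<lambda>m. I m \<omega>))
    \<le> sqrt (expectation (\<lambda>\<omega>. (f (\<lambda>m. I m \<omega>))\<^sup>2) * expectation (\<lambda>\<omega>. (g (\<lambda>m. I m \<omega>))\<^sup>2))"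
proof -
  let ?q = "sqrt ((1 / real (card (batches p b))) ^ n)"
  have fg: "determined_by n (\<lambda>J. f J * g J)" "determined_by n (\<lambda>J. (f J)\<^sup>2)"
    "determined_by n (\<lambda>J. (g J)\<^sup>2)"
    using determined_byD[OF f] determined_byD[OF g] by (intro determined_byI; metis)+
  have q: "?q * ?q = (1 / real (card (batches p b))) ^ n" by simp
  have "(\<Sum>K\<in>paths n. f K * g K * (?q * ?q)) \<le> (\<Sum>K\<in>paths n. \<bar>f K * ?q\<bar> * \<bar>g K * ?q\<bar>)"
  proof (rule sum_mono)
    fix K
    have "f K * g K * (?q * ?q) = (f K * ?q) * (g K * ?q)" by (simp only: mult_ac)
    also have "\<dots> \<le> \<bar>f K * ?q\<bar> * \<bar>g K * ?q\<bar>" by (metis abs_ge_self abs_mult)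
    finally show "f K * g K * (?q * ?q) \<le> \<bar>f K * ?q\<bar> * \<bar>g K * ?q\<bar>" .
  qed
  also have "\<dots> \<le> L2_set (\<lambda>K. f K * ?q) (paths n) * L2_set (\<lambda>K. g K * ?q) (paths n)"
    by (rule L2_set_mult_ineq)
  also have "\<dots> = sqrt ((\<Sum>K\<in>paths n. (f K)\<^sup>2 * (?q * ?q)) * (\<Sum>K\<in>paths n. (g K)\<^sup>2 * (?q * ?q)))"
    by (simp only: L2_set_def real_sqrt_mult power2_eq_square mult_ac)
  finally show ?thesis
    unfolding q using determined_expectation[OF fg(1)] determined_expectation[OF fg(2)]
      determined_expectation[OF fg(3)] by simp
qed

end


section \<open>Convergence\<close>

text \<open>Choose \<open>l\<close> so that the tail of the series beyond \<open>l\<close> is small, then \<open>K\<close> so large that \<open>s K\<close> is tiny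
  compared with the terms before \<open>l\<close>, and let \<open>s n\<close> be minimal on \<open>{l..K}\<close>. Terms with \<open>m < l\<close> are then
  controlled by \<open>s n \<le> s K\<close>, and for the others \<open>sqrt (s m * s n) \<le> s m\<close>.\<close>

lemma almost_minimal_index:
  fixes s :: "nat \<Rightarrow> real"
  assumes nonneg: "\<And>n. 0 \<le> s n" and sum: "summable s" and \<epsilon>: "0 < \<epsilon>"
  shows "\<exists>n. s n < \<epsilon> \<and> (\<Sum>m<n. sqrt (s m * s n)) < \<epsilon>"
proof -
  obtain l where "\<And>a b. l \<le> a \<Longrightarrow> norm (sum s {a..<b}) < \<epsilon> / 2"
    using sum \<epsilon> unfolding summable_Cauchy by (meson half_gt_zero)
  then have tail: "sum s {l..<n} < \<epsilon> / 2" for n by (smt (verit) order_refl real_norm_def)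
  define T where "T = (\<Sum>m<l. sqrt (s m))"
  have T: "0 \<le> T" unfolding T_def by (intro sum_nonneg) (use nonneg in simp)
  have s0: "s \<longlonglongrightarrow> 0" by (rule summable_LIMSEQ_zero[OF sum])
  have "(\<lambda>n. T * sqrt (s n)) \<longlonglongrightarrow> T * sqrt 0" by (intro tendsto_intros s0)
  then have "\<forall>\<^sub>F n in sequentially. T * sqrt (s n) < \<epsilon> / 2"
    by (rule order_tendstoD(2)) (use \<epsilon> in simp)
  moreover have "\<forall>\<^sub>F n in sequentially. s n < \<epsilon>" by (rule order_tendstoD(2)[OF s0 \<epsilon>])
  moreover have "\<forall>\<^sub>F n in sequentially. l \<le> n" by (rule eventually_ge_at_top)
  ultimately have "\<forall>\<^sub>F n in sequentially. T * sqrt (s n) < \<epsilon> / 2 \<and> s n < \<epsilon> \<and> l \<le> n"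
    by eventually_elim simp
  then obtain K where K: "T * sqrt (s K) < \<epsilon> / 2" "s K < \<epsilon>" "l \<le> K"
    using eventually_happens'[OF sequentially_bot] by blast
  have "\<exists>n\<in>{l..K}. \<forall>m\<in>{l..K}. s n \<le> s m"
    using ex_min_if_finite[of "s ` {l..K}"] K(3) by (fastforce simp: not_less)
  then obtain n where n: "n \<in> {l..K}" and least: "\<And>m. m \<in> {l..K} \<Longrightarrow> s n \<le> s m" by blast
  have nK: "s n \<le> s K" using least K(3) by simp
  have "(\<Sum>m<n. sqrt (s m * s n)) = (\<Sum>m<l. sqrt (s m * s n)) + (\<Sum>m\<in>{l..<n}. sqrt (s m * s n))"
    using n by (subst sum.union_disjoint[symmetric]) (auto intro: sum.cong)
  also have "(\<Sum>m<l. sqrt (s m * s n)) = T * sqrt (s n)"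
    by (simp add: T_def real_sqrt_mult sum_distrib_right)
  also have "\<dots> \<le> T * sqrt (s K)" using T nK by (intro mult_left_mono) auto
  also have "(\<Sum>m\<in>{l..<n}. sqrt (s m * s n)) \<le> sum s {l..<n}"
  proof (rule sum_mono)
    fix m assume "m \<in> {l..<n}"
    then have "s n \<le> s m" using n by (intro least) auto
    then have "sqrt (s m * s n) \<le> sqrt (s m * s m)"
      using nonneg by (intro real_sqrt_le_mono mult_left_mono) auto
    then show "sqrt (s m * s n) \<le> s m" using nonneg by simp
  qed
  finally have "(\<Sum>m<n. sqrt (s m * s n)) < \<epsilon>" using K(1) tail[of n] by linarith
  moreover have "s n < \<epsilon>" using nK K(2) by linarith
  ultimately show ?thesis by blast
qed

locale stochastic_mirror_descent =
  mirror_descent R \<sigma> A y p xdag \<mu>0 \<mu>1 \<tau> + uniform_batches M p b I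
  for R :: "'x::banach \<Rightarrow> ereal" and \<sigma> :: real
    and A :: "nat \<Rightarrow> 'x \<Rightarrow>\<^sub>L 'y::real_inner" and y :: "nat \<Rightarrow> 'y" and p :: nat and xdag :: 'x
    and \<mu>0 \<mu>1 \<tau> :: real and M :: "'w measure" and b :: nat and I :: "nat \<Rightarrow> 'w \<Rightarrow> nat set"
begin

lemma dual_determined: "m \<le> n \<Longrightarrow> determined_by n (\<lambda>J. g (dual \<delta> yd J m))"
  by (rule determined_byI) (auto intro!: arg_cong[where f = g] dual_local)

lemma gap_integrable: "integrable M (\<lambda>\<omega>. gap (dual \<delta> yd (\<lambda>m. I m \<omega>) n))"
  by (rule determined_integrable[OF dual_determined[OF order_refl]])

lemma expected_gap_antimono:
  assumes noise: "\<And>i. i \<in> {1..p} \<Longrightarrow> norm (yd i - y i) \<le> \<delta> i" and "n \<le> n'"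
  shows "expectation (\<lambda>\<omega>. gap (dual \<delta> yd (\<lambda>m. I m \<omega>) n'))
    \<le> expectation (\<lambda>\<omega>. gap (dual \<delta> yd (\<lambda>m. I m \<omega>) n))"
  using \<open>n \<le> n'\<close>
proof (induction n' rule: dec_induct)
  case (step k)
  have "expectation (\<lambda>\<omega>. gap (dual \<delta> yd (\<lambda>m. I m \<omega>) (Suc k)))
      \<le> expectation (\<lambda>\<omega>. gap (dual \<delta> yd (\<lambda>m. I m \<omega>) k))"
    by (intro integral_mono gap_integrable gap_dual_Suc_le I_subset noise)
  then show ?case using step.IH by linarith
qed simp

text \<open>Every equation occurs in at least one batch.\<close>

lemma sum_batches_ge: "(prod_norm {1..p} r)\<^sup>2 \<le> (\<Sum>S\<in>batches p b. (prod_norm S r)\<^sup>2)"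
proof -
  have "(prod_norm {1..p} r)\<^sup>2 \<le> (\<Sum>i\<in>{1..p}. \<Sum>S\<in>batches p b. if i \<in> S then (norm (r i))\<^sup>2 else 0)"
    unfolding prod_norm_power2
  proof (rule sum_mono)
    fix i assume "i \<in> {1..p}"
    then obtain S where S: "S \<in> batches p b" "i \<in> S" using batch_exists by blast
    then have "(norm (r i))\<^sup>2 = (if i \<in> S then (norm (r i))\<^sup>2 else 0)" by simp
    also have "\<dots> \<le> (\<Sum>S\<in>batches p b. if i \<in> S then (norm (r i))\<^sup>2 else 0)"
      using S by (intro member_le_sum) auto
    finally show "(norm (r i))\<^sup>2 \<le> (\<Sum>S\<in>batches p b. if i \<in> S then (norm (r i))\<^sup>2 else 0)" .
  qed
  also have "\<dots> = (\<Sum>S\<in>batches p b. \<Sum>i\<in>{1..p}. if i \<in> S then (norm (r i))\<^sup>2 else 0)"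
    by (rule sum.swap)
  also have "\<dots> = (\<Sum>S\<in>batches p b. (prod_norm S r)\<^sup>2)"
  proof (rule sum.cong[OF refl])
    fix S assume "S \<in> batches p b"
    then have "{1..p} \<inter> S = S" by (auto simp: batches_def)
    then show "(\<Sum>i\<in>{1..p}. if i \<in> S then (norm (r i))\<^sup>2 else 0) = (prod_norm S r)\<^sup>2"
      by (simp only: prod_norm_power2 sum.inter_restrict[OF finite_atLeastAtMost, symmetric])
  qed
  finally show ?thesis .
qed

abbreviation mean_misfit :: "nat \<Rightarrow> real" where
  "mean_misfit n \<equiv> expectation (\<lambda>\<omega>. (misfit (X (exact (\<lambda>m. I m \<omega>) n)))\<^sup>2)"

text \<open>The residual of the current batch is paid for by the loss of gap, and after averaging over the
  fresh batch it dominates the full misfit up to a constant. The losses telescope.\<close>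

lemma mean_misfit_summable: "summable mean_misfit"
proof -
  obtain c where c: "0 < c" and dec: "\<And>J n. J n \<subseteq> {1..p} \<Longrightarrow> gap (exact J (Suc n))
      \<le> gap (exact J n) - c * (prod_norm (J n) (residual A y (X (exact J n))))\<^sup>2"
    using gap_exact_decrease by blast
  define N where "N = real (card (batches p b))"
  have N: "0 < N" using card_batches_pos by (simp add: N_def)
  define G where "G = (\<lambda>n. expectation (\<lambda>\<omega>. gap (exact (\<lambda>m. I m \<omega>) n)))"
  have G0: "0 \<le> G n" for n
    unfolding G_def by (intro Bochner_Integration.integral_nonneg gap_nonneg)
  let ?h = "\<lambda>n S J. (prod_norm S (residual A y (X (exact J n))))\<^sup>2"
  have det: "determined_by n (?h n S)" for n S
    by (rule dual_determined[OF order_refl, of n "\<lambda>\<xi>. (prod_norm S (residual A y (X \<xi>)))\<^sup>2"])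
  have det': "determined_by (Suc n) (\<lambda>J. ?h n (J n) J)" for n
  proof (rule determined_byI)
    fix J J' :: "nat \<Rightarrow> nat set" assume J: "\<And>m. m < Suc n \<Longrightarrow> J m = J' m"
    have "exact J n = exact J' n" by (rule dual_local) (simp add: J)
    then show "?h n (J n) J = ?h n (J' n) J'" by (simp add: J)
  qed
  have one: "mean_misfit n \<le> N / c * (G n - G (Suc n))" for n
  proof -
    have "mean_misfit n \<le> expectation (\<lambda>\<omega>. \<Sum>S\<in>batches p b. ?h n S (\<lambda>m. I m \<omega>))"
      by (intro integral_mono determined_integrable[OF det] Bochner_Integration.integrable_sum
          sum_batches_ge)
    also have "\<dots> = (\<Sum>S\<in>batches p b. expectation (\<lambda>\<omega>. ?h n S (\<lambda>m. I m \<omega>)))"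
      by (intro Bochner_Integration.integral_sum determined_integrable[OF det])
    also have "\<dots> = N * expectation (\<lambda>\<omega>. ?h n (I n \<omega>) (\<lambda>m. I m \<omega>))"
      using N by (subst expectation_fresh_batch[OF det]) (simp add: N_def)
    finally have 1: "mean_misfit n \<le> N * expectation (\<lambda>\<omega>. ?h n (I n \<omega>) (\<lambda>m. I m \<omega>))" .
    have int: "integrable M (\<lambda>\<omega>. ?h n (I n \<omega>) (\<lambda>m. I m \<omega>))"
      using determined_integrable[OF det'] .
    have "G (Suc n) \<le> expectation (\<lambda>\<omega>. gap (exact (\<lambda>m. I m \<omega>) n) - c * ?h n (I n \<omega>) (\<lambda>m. I m \<omega>))"
      unfolding G_def
      by (intro integral_mono Bochner_Integration.integrable_diff integrable_mult_right int
          gap_integrable dec I_subset)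
    also have "\<dots> = G n - c * expectation (\<lambda>\<omega>. ?h n (I n \<omega>) (\<lambda>m. I m \<omega>))"
      using int gap_integrable by (simp add: G_def)
    finally have "expectation (\<lambda>\<omega>. ?h n (I n \<omega>) (\<lambda>m. I m \<omega>)) \<le> (G n - G (Suc n)) / c"
      using c by (simp add: field_simps)
    then have "N * expectation (\<lambda>\<omega>. ?h n (I n \<omega>) (\<lambda>m. I m \<omega>)) \<le> N * ((G n - G (Suc n)) / c)"
      using N by (intro mult_left_mono) auto
    then show ?thesis using 1 by simp
  qed
  show ?thesis
  proof (rule summableI_nonneg_bounded)
    show "0 \<le> mean_misfit n" for n by (intro Bochner_Integration.integral_nonneg) simp
    fix n
    have "(\<Sum>i<n. mean_misfit i) \<le> (\<Sum>i<n. N / c * (G i - G (Suc i)))"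
      by (intro sum_mono one)
    also have "\<dots> = N / c * (G 0 - G n)"
      by (simp only: sum_distrib_left[symmetric] sum_lessThan_telescope')
    also have "\<dots> \<le> N / c * G 0" using N c G0 by (intro mult_left_mono) auto
    finally show "(\<Sum>i<n. mean_misfit i) \<le> N / c * G 0" .
  qed
qed

text \<open>The bound of \<open>gap_exact_le\<close> is averaged, with Cauchy-Schwarz applied to each product of misfits, and
  evaluated at an almost minimal index.\<close>

lemma exact_gap_small:
  assumes \<epsilon>: "0 < \<epsilon>"
  shows "\<exists>n. expectation (\<lambda>\<omega>. gap (exact (\<lambda>m. I m \<omega>) n)) < \<epsilon>"
proof -
  obtain C where C: "0 \<le> C" and le: "\<And>J n. (\<And>m. m < n \<Longrightarrow> J m \<subseteq> {1..p}) \<Longrightarrow> gap (exact J n)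
      \<le> \<epsilon> / 2 + C * (misfit (X (exact J n)))\<^sup>2
        + \<mu>1 * (\<Sum>m<n. misfit (X (exact J m)) * misfit (X (exact J n)))"
    using gap_exact_le[of "\<epsilon> / 2"] \<epsilon> by auto
  define \<epsilon>' where "\<epsilon>' = \<epsilon> / 2 / (C + \<mu>1)"
  have pos: "0 < C + \<mu>1" using C mu1_pos by simp
  then have \<epsilon>': "0 < \<epsilon>'" using \<epsilon> by (simp add: \<epsilon>'_def)
  have nonneg: "0 \<le> mean_misfit n" for n by (intro Bochner_Integration.integral_nonneg) simp
  obtain n where n: "mean_misfit n < \<epsilon>'" "(\<Sum>m<n. sqrt (mean_misfit m * mean_misfit n)) < \<epsilon>'"
    using almost_minimal_index[OF nonneg mean_misfit_summable \<epsilon>'] by blast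
  let ?e = "\<lambda>m \<omega>. misfit (X (exact (\<lambda>m. I m \<omega>) m))"
  have det: "determined_by n (\<lambda>J. misfit (X (exact J m)))" if "m \<le> n" for m
    using dual_determined[OF that, of "\<lambda>\<xi>. misfit (X \<xi>)"] .
  have det2: "determined_by n (\<lambda>J. (misfit (X (exact J n)))\<^sup>2)"
    using dual_determined[OF order_refl, of n "\<lambda>\<xi>. (misfit (X \<xi>))\<^sup>2"] .
  have int: "integrable M (\<lambda>\<omega>. ?e m \<omega> * ?e n \<omega>)" if "m < n" for m
  proof -
    have "determined_by n (\<lambda>J. misfit (X (exact J m)) * misfit (X (exact J n)))"
    proof (rule determined_byI)
      fix J J' :: "nat \<Rightarrow> nat set" assume J: "\<And>m. m < n \<Longrightarrow> J m = J' m"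
      have "exact J m = exact J' m" "exact J n = exact J' n"
        using that by (auto intro!: dual_local J)
      then show "misfit (X (exact J m)) * misfit (X (exact J n))
          = misfit (X (exact J' m)) * misfit (X (exact J' n))" by simp
    qed
    then show ?thesis by (rule determined_integrable)
  qed
  note int2 = determined_integrable[OF det2]
  have "expectation (\<lambda>\<omega>. gap (exact (\<lambda>m. I m \<omega>) n))
      \<le> expectation (\<lambda>\<omega>. \<epsilon> / 2 + C * (?e n \<omega>)\<^sup>2 + \<mu>1 * (\<Sum>m<n. ?e m \<omega> * ?e n \<omega>))"
    by (intro integral_mono gap_integrable Bochner_Integration.integrable_add integrable_const
        integrable_mult_right int2 Bochner_Integration.integrable_sum int le I_subset) auto
  also have "\<dots> = \<epsilon> / 2 + C * mean_misfit n + \<mu>1 * (\<Sum>m<n. expectation (\<lambda>\<omega>. ?e m \<omega> * ?e n \<omega>))"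
  proof -
    have linear: "expectation (\<lambda>\<omega>. a + c * f \<omega> + d * g \<omega>) = a + c * expectation f + d * expectation g"
      if "integrable M f" "integrable M g" for f g and a c d :: real
      using that by (simp add: prob_space)
    have "integrable M (\<lambda>\<omega>. \<Sum>m<n. ?e m \<omega> * ?e n \<omega>)"
      by (intro Bochner_Integration.integrable_sum int) auto
    moreover have "expectation (\<lambda>\<omega>. \<Sum>m<n. ?e m \<omega> * ?e n \<omega>)
        = (\<Sum>m<n. expectation (\<lambda>\<omega>. ?e m \<omega> * ?e n \<omega>))"
      by (intro Bochner_Integration.integral_sum int) auto
    ultimately show ?thesis by (simp only: linear[OF int2])
  qed
  also have "\<dots> \<le> \<epsilon> / 2 + C * mean_misfit n + \<mu>1 * (\<Sum>m<n. sqrt (mean_misfit m * mean_misfit n))"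
    using mu1_pos
    by (intro add_left_mono mult_left_mono sum_mono expectation_mult_le_sqrt[of n] det) auto
  also have "\<dots> < \<epsilon> / 2 + C * \<epsilon>' + \<mu>1 * \<epsilon>'"
    using n C mu1_pos by (intro add_le_less_mono add_left_mono mult_left_mono mult_strict_left_mono) auto
  also have "\<dots> = \<epsilon> / 2 + (C + \<mu>1) * \<epsilon>'" by (simp add: distrib_right)
  also have "(C + \<mu>1) * \<epsilon>' = \<epsilon> / 2"
  proof -
    have "c * (\<epsilon> / 2 / c) = \<epsilon> / 2" if "0 < c" for c :: real using that by simp
    then show ?thesis using pos unfolding \<epsilon>'_def by blast
  qed
  finally show ?thesis by auto
qed

lemma expected_gap_tendsto_exact:
  assumes "\<And>i. i \<in> {1..p} \<Longrightarrow> ((\<lambda>k. \<delta> k i) \<longlongrightarrow> 0) F"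
    and "\<And>i. i \<in> {1..p} \<Longrightarrow> ((\<lambda>k. yd k i) \<longlongrightarrow> y i) F"
  shows "((\<lambda>k. expectation (\<lambda>\<omega>. gap (dual (\<delta> k) (yd k) (\<lambda>m. I m \<omega>) n)))
    \<longlongrightarrow> expectation (\<lambda>\<omega>. gap (exact (\<lambda>m. I m \<omega>) n))) F"
proof -
  have "((\<lambda>k. gap (dual (\<delta> k) (yd k) K n)) \<longlongrightarrow> gap (exact K n)) F" if "K \<in> paths n" for K
  proof (intro gap_tendsto dual_tendsto_exact assms)
    fix m assume "m < n"
    then have "K m \<in> batches p b" using that by auto
    then show "K m \<subseteq> {1..p}" by (simp add: batches_def)
  qed
  then show ?thesis
    unfolding determined_expectation[OF dual_determined[OF order_refl, where g = gap]]
    by (intro tendsto_sum tendsto_mult_right)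
qed

text \<open>Fix \<open>n\<close> with small exact expected gap. The noisy expected gap after \<open>n\<close> steps is eventually small, and
  it can only decrease up to step \<open>N k \<ge> n\<close>.\<close>

lemma expected_gap_tendsto_zero:
  assumes \<delta>: "\<And>i. i \<in> {1..p} \<Longrightarrow> ((\<lambda>k. \<delta> k i) \<longlongrightarrow> 0) F"
    and noise: "\<And>k i. i \<in> {1..p} \<Longrightarrow> norm (yd k i - y i) \<le> \<delta> k i"
    and N: "filterlim N at_top F"
  shows "((\<lambda>k. expectation (\<lambda>\<omega>. gap (dual (\<delta> k) (yd k) (\<lambda>m. I m \<omega>) (N k)))) \<longlongrightarrow> 0) F"
proof -
  let ?G = "\<lambda>k n. expectation (\<lambda>\<omega>. gap (dual (\<delta> k) (yd k) (\<lambda>m. I m \<omega>) n))"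
  have yd: "((\<lambda>k. yd k i) \<longlongrightarrow> y i) F" if "i \<in> {1..p}" for i
  proof (rule LIM_zero_cancel)
    show "((\<lambda>k. yd k i - y i) \<longlongrightarrow> 0) F"
      using noise[OF that] by (intro Lim_null_comparison[OF _ \<delta>[OF that]]) auto
  qed
  have "\<forall>\<^sub>F k in F. ?G k (N k) < \<epsilon>" if \<epsilon>: "0 < \<epsilon>" for \<epsilon>
  proof -
    obtain n where n: "expectation (\<lambda>\<omega>. gap (exact (\<lambda>m. I m \<omega>) n)) < \<epsilon>"
      using exact_gap_small[OF \<epsilon>] by blast
    have "\<forall>\<^sub>F k in F. ?G k n < \<epsilon>"
      by (rule order_tendstoD(2)[OF expected_gap_tendsto_exact[OF \<delta> yd] n])
    moreover have "\<forall>\<^sub>F k in F. n \<le> N k" using N by (simp add: filterlim_at_top)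
    ultimately show ?thesis
    proof eventually_elim
      case (elim k)
      have "?G k (N k) \<le> ?G k n" by (rule expected_gap_antimono[OF noise elim(2)])
      then show ?case using elim(1) by linarith
    qed
  qed
  moreover have "0 \<le> ?G k n" for k n
    by (intro Bochner_Integration.integral_nonneg gap_nonneg)
  ultimately show ?thesis
    by (intro order_tendstoI) (auto intro!: always_eventually intro: less_le_trans)
qed

lemma expected_distance_le:
  "\<sigma> * expectation (\<lambda>\<omega>. (norm (X (dual \<delta> yd (\<lambda>m. I m \<omega>) n) - xdag))\<^sup>2)
    \<le> expectation (\<lambda>\<omega>. gap (dual \<delta> yd (\<lambda>m. I m \<omega>) n))"
proof -
  have "integrable M (\<lambda>\<omega>. (norm (X (dual \<delta> yd (\<lambda>m. I m \<omega>) n) - xdag))\<^sup>2)"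
    using determined_integrable[OF dual_determined[OF order_refl, of n "\<lambda>\<xi>. (norm (X \<xi> - xdag))\<^sup>2"]] .
  then have "expectation (\<lambda>\<omega>. \<sigma> * (norm (X (dual \<delta> yd (\<lambda>m. I m \<omega>) n) - xdag))\<^sup>2)
      \<le> expectation (\<lambda>\<omega>. gap (dual \<delta> yd (\<lambda>m. I m \<omega>) n))"
    by (intro integral_mono integrable_mult_right gap_integrable gap_ge)
  then show ?thesis by simp
qed

end

theorem theorem3p6:
  fixes R :: "'x::banach \<Rightarrow> ereal"
    and A :: "nat \<Rightarrow> 'x \<Rightarrow>\<^sub>L 'y::real_inner"
    and Y :: "nat \<Rightarrow> 'y set"
    and y :: "nat \<Rightarrow> 'y"
    and xdag :: 'x
    and p b :: nat
    and \<sigma> \<mu>0 \<mu>1 \<tau> :: real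
    and M :: "'w measure"
    and I :: "nat \<Rightarrow> 'w \<Rightarrow> nat set"
    and F :: "'k filter"
    and \<delta> :: "'k \<Rightarrow> nat \<Rightarrow> real"
    and yd :: "'k \<Rightarrow> nat \<Rightarrow> 'y"
    and N :: "'k \<Rightarrow> nat"
  assumes "proper R" and "lower_semicontinuous R"
    and "\<sigma> > 0" and "modulus_of_convexity R \<sigma>"
    and "\<And>i. i \<in> {1..p} \<Longrightarrow> hilbert_subspace (Y i)"
    and "\<And>i x. i \<in> {1..p} \<Longrightarrow> blinfun_apply (A i) x \<in> Y i"
    and "\<And>i. i \<in> {1..p} \<Longrightarrow> y i \<in> Y i"
    and "\<exists>x\<in>eff_dom R. \<forall>i\<in>{1..p}. blinfun_apply (A i) x = y i"
    and "is_arg_min R (\<lambda>x. \<forall>i\<in>{1..p}. blinfun_apply (A i) x = y i) xdag"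
    and "b \<in> {1..p}"
    and "prob_space M" and "iid_uniform_batches M p b I"
    and "\<tau> > 1" and "0 < \<mu>0" and "\<mu>0 < 4 * \<sigma>" and "\<mu>1 > 0"
    and "1 - 1 / \<tau> - \<mu>0 / (4 * \<sigma>) \<ge> 0"
    and "\<And>k i. i \<in> {1..p} \<Longrightarrow> \<delta> k i > 0"
    and "\<And>k i. i \<in> {1..p} \<Longrightarrow> yd k i \<in> Y i"
    and "\<And>k i. i \<in> {1..p} \<Longrightarrow> norm (yd k i - y i) \<le> \<delta> k i"
    and "((\<lambda>k. noise_level {1..p} (\<delta> k)) \<longlongrightarrow> 0) F"
    and "filterlim N at_top F"
  shows "((\<lambda>k. prob_space.expectation M (\<lambda>\<omega>.
          (norm (smd_primal R A \<mu>0 \<mu>1 \<tau> (\<delta> k) (yd k) (\<lambda>m. I m \<omega>) (N k) - xdag))\<^sup>2)) \<longlongrightarrow> 0) F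
    \<and> ((\<lambda>k. prob_space.expectation M (\<lambda>\<omega>.
          real_of_ereal (bregman R
            (smd_dual R A \<mu>0 \<mu>1 \<tau> (\<delta> k) (yd k) (\<lambda>m. I m \<omega>) (N k))
            xdag
            (smd_primal R A \<mu>0 \<mu>1 \<tau> (\<delta> k) (yd k) (\<lambda>m. I m \<omega>) (N k))))) \<longlongrightarrow> 0) F"
proof -
  have sol: "\<forall>i\<in>{1..p}. blinfun_apply (A i) xdag = y i"
    and least: "\<And>x. \<forall>i\<in>{1..p}. blinfun_apply (A i) x = y i \<Longrightarrow> R xdag \<le> R x"
    using assms(9) by (auto simp: is_arg_min_linorder)
  have dom: "xdag \<in> eff_dom R"
    using assms(8) least unfolding eff_dom_def by force
  interpret prob_space M by (rule assms(11))
  interpret stochastic_mirror_descent R \<sigma> A y p xdag \<mu>0 \<mu>1 \<tau> M b I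
  proof
    show "strongly_convex_with R \<sigma>" using assms(4) by (simp add: modulus_of_convexity_def)
    show "blinfun_apply (A i) xdag = y i" if "i \<in> {1..p}" for i using sol that by blast
    show "R xdag \<le> R x" if "\<And>i. i \<in> {1..p} \<Longrightarrow> blinfun_apply (A i) x = y i" for x
      using least that by blast
  qed (use assms dom in auto)
  let ?G = "\<lambda>k. expectation (\<lambda>\<omega>. gap (dual (\<delta> k) (yd k) (\<lambda>m. I m \<omega>) (N k)))"
  let ?D = "\<lambda>k. expectation (\<lambda>\<omega>. (norm (X (dual (\<delta> k) (yd k) (\<lambda>m. I m \<omega>) (N k)) - xdag))\<^sup>2)"
  have \<delta>: "((\<lambda>k. \<delta> k i) \<longlongrightarrow> 0) F" if i: "i \<in> {1..p}" for i
  proof (rule tendsto_sandwich)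
    show "\<forall>\<^sub>F k in F. 0 \<le> \<delta> k i"
      using assms(18)[OF i] by (intro always_eventually) (simp add: less_imp_le)
    show "\<forall>\<^sub>F k in F. \<delta> k i \<le> noise_level {1..p} (\<delta> k)"
      unfolding noise_level_L2 using i by (intro always_eventually allI member_le_L2_set) auto
  qed (use assms(21) in auto)
  have G: "(?G \<longlongrightarrow> 0) F"
    by (rule expected_gap_tendsto_zero[OF \<delta> assms(20) assms(22)])
  have "(?D \<longlongrightarrow> 0) F"
  proof (rule tendsto_sandwich)
    show "\<forall>\<^sub>F k in F. 0 \<le> ?D k"
      by (intro always_eventually allI Bochner_Integration.integral_nonneg) simp
    show "\<forall>\<^sub>F k in F. ?D k \<le> ?G k / \<sigma>"
      using expected_distance_le sigma_pos
      by (intro always_eventually allI) (simp add: pos_le_divide_eq mult.commute)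
    show "((\<lambda>k. ?G k / \<sigma>) \<longlongrightarrow> 0) F" using tendsto_divide[OF G tendsto_const] sigma_pos by fastforce
  qed simp
  then show ?thesis using G by (simp add: smd_primal_def bregman_eq_gap)
qed

end
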